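(* Let $\mathbf k$ be an algebraically closed field of characteristic $p>0$, $X$ a smooth curve over $\mathbf k$, and $\nabla(s)=d-B(s)$ a periodic $1$-parameter polynomial family of connections on $X$. If $\nabla(s)$ is a pseudo-pencil trivializable at $0$, then its $p$-curvature is isospectral to $(s-s^p)B_\infty^{(1)}$ and also to $-(s-s^p)\partial^{p-1}B_0$. In particular, $B_\infty^{(1)}$ is isospectral to $-\partial^{p-1}B_0$.
   Context: The connections are on the trivial bundle with fiber $V$, $\dim V=N$, and $B(s)$ is polynomial in $s$ with coefficients in $\Omega^1(X)\otimes\mathrm{End}\,V$. Using a local coordinate $x$ on $X$, $1$-forms are identified with functions and $\partial=d/dx$. Periodic: there is $A\in GL(V)(\mathbf k(s)[X])$ with $\nabla(s+1)\circ A(s)=A(s)\circ\nabla(s)$. Pseudo-pencil: $\nabla(s)$ is gauge equivalent over $\mathbf k(X)(s)$ (equivalently over $\mathbf k(X)((s))$) to $d-sB_\infty(s)$ with $B_\infty(s)$ regular at $s=\infty$; $B_\infty:=B_\infty(\infty)$. Trivializable at $0$: there is a gauge transformation over $\mathbf k(X)(s)$ (equivalently over $\mathbf k(X)((s))$) transforming $\nabla(s)$ to $d-sB_0(s)$ with $B_0(s)$ regular at $s=0$; $B_0:=B_0(0)$. The $p$-curvature is the matrix $C(s)=\nabla_x(s)^p$, where $\nabla_x(s)$ is the covariant derivative along $\partial$. $B^{(1)}$ denotes the Frobenius twist: the entries of $B$ are raised to the power $p$. Two matrices are isospectral if they have the same characteristic polynomial. *)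

theory Defs
  imports
    "Jordan_Normal_Form.Char_Poly"
    "HOL-Computational_Algebra.Computational_Algebra"
begin

section \<open>Function fields and smooth curves\<close>

text \<open>
  Throughout, \<open>\<iota> :: 'k \<Rightarrow> 'K\<close> is the structure map of a field extension.
\<close>

definition subfield_set :: "'a::field set \<Rightarrow> bool" where
  "subfield_set F \<longleftrightarrow> 1 \<in> F \<and> (\<forall>a\<in>F. \<forall>b\<in>F. a - b \<in> F \<and> a * b \<in> F \<and> inverse a \<in> F)"

definition transcendental_over :: "('k::field \<Rightarrow> 'K::field) \<Rightarrow> 'K \<Rightarrow> bool" where
  "transcendental_over \<iota> y \<longleftrightarrow> (\<forall>q::'k poly. q \<noteq> 0 \<longrightarrow> poly (map_poly \<iota> q) y \<noteq> 0)"

text \<open>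
  A bivariate polynomial \<open>F(Y,Z)\<close> is an element of \<open>'k poly poly\<close>: the outer variable is \<open>Z\<close>.
\<close>
definition alg_dependent :: "('k::field \<Rightarrow> 'K::field) \<Rightarrow> 'K \<Rightarrow> 'K \<Rightarrow> bool" where
  "alg_dependent \<iota> y z \<longleftrightarrow>
     (\<exists>F::'k poly poly. F \<noteq> 0 \<and> poly (map_poly (\<lambda>q. poly (map_poly \<iota> q) y) F) z = 0)"

text \<open>
  Finitely generated field extensions of transcendence degree one, i.e. such that the largest
  algebraically independent subsets have exactly one element.
\<close>
definition function_field :: "('k::field \<Rightarrow> 'K::field) \<Rightarrow> bool" where
  "function_field \<iota> \<longleftrightarrow>
     field_hom \<iota>
     \<and> (\<exists>S. finite S \<and> (\<forall>F. subfield_set F \<and> range \<iota> \<subseteq> F \<and> S \<subseteq> F \<longrightarrow> F = UNIV))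
     \<and> (\<exists>y. transcendental_over \<iota> y)
     \<and> (\<forall>y z. alg_dependent \<iota> y z)"

text \<open>
  A subring \<open>R\<close> of \<open>'K\<close> is a discrete valuation ring with fraction field \<open>'K\<close> and uniformizer \<open>t\<close>
  iff \<open>t\<close> is a nonzero nonunit of \<open>R\<close> and every nonzero element of \<open>'K\<close> is an integer power
  of \<open>t\<close> times a unit of \<open>R\<close>.
\<close>
definition uniformizer :: "'K::field set \<Rightarrow> 'K \<Rightarrow> bool" where
  "uniformizer R t \<longleftrightarrow>
     t \<in> R \<and> t \<noteq> 0 \<and> inverse t \<notin> R \<and>
     (\<forall>z. z \<noteq> 0 \<longrightarrow> (\<exists>(n::int) u. u \<in> R \<and> inverse u \<in> R \<and> z = t powi n * u))"

definition dvr_of_extension :: "('k::field \<Rightarrow> 'K::field) \<Rightarrow> 'K set \<Rightarrow> bool" where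
  "dvr_of_extension \<iota> R \<longleftrightarrow>
     range \<iota> \<subseteq> R \<and> (\<forall>a\<in>R. \<forall>b\<in>R. a - b \<in> R \<and> a * b \<in> R) \<and> (\<exists>t. uniformizer R t)"

text \<open>
  Smooth (irreducible, separated) curves over an algebraically closed field, as abstract
  nonsingular curves in the sense of Hartshorne, I.6: the function field is \<open>'K\<close>, a (closed)
  point is given by its local ring, which is a discrete valuation ring of the extension
  \<open>\<iota>\<close>, and the curve is a nonempty open, i.e. cofinite, subset of the set of all
  these rings. Affine and projective curves are both covered.
\<close>
definition smooth_curve :: "('k::alg_closed_field \<Rightarrow> 'K::field) \<Rightarrow> 'K set set \<Rightarrow> bool" where
  "smooth_curve \<iota> X \<longleftrightarrow>
     function_field \<iota> \<and> X \<noteq> {} \<and>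
     X \<subseteq> Collect (dvr_of_extension \<iota>) \<and> finite (Collect (dvr_of_extension \<iota>) - X)"

definition regular_functions :: "'K::field set set \<Rightarrow> 'K set" where
  "regular_functions X = \<Inter> X"

text \<open>\<open>x\<close> is a local coordinate near some point \<open>P\<close> of \<open>X\<close>: \<open>x - x(P)\<close> is a uniformizer at \<open>P\<close>.\<close>
definition local_coordinate :: "('k::field \<Rightarrow> 'K::field) \<Rightarrow> 'K set set \<Rightarrow> 'K \<Rightarrow> bool" where
  "local_coordinate \<iota> X x \<longleftrightarrow> (\<exists>P\<in>X. \<exists>c. uniformizer P (x - \<iota> c))"

definition derivation_over :: "('k::field \<Rightarrow> 'K::field) \<Rightarrow> ('K \<Rightarrow> 'K) \<Rightarrow> bool" where
  "derivation_over \<iota> D \<longleftrightarrow>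
     (\<forall>a b. D (a + b) = D a + D b) \<and> (\<forall>a b. D (a * b) = D a * b + a * D b) \<and> (\<forall>c. D (\<iota> c) = 0)"

text \<open>
  \<open>D = d/dx\<close>. The \<open>\<iota>\<close>-derivation with \<open>D x = 1\<close> is unique when \<open>x\<close> is a local coordinate.
\<close>
definition coordinate_derivation :: "('k::field \<Rightarrow> 'K::field) \<Rightarrow> 'K \<Rightarrow> ('K \<Rightarrow> 'K) \<Rightarrow> bool" where
  "coordinate_derivation \<iota> x D \<longleftrightarrow> derivation_over \<iota> D \<and> D x = 1"

text \<open>
  Rational 1-forms are \<open>f dx\<close> with \<open>f\<close> in \<open>'K\<close>, and \<open>dh = D h dx\<close> for \<open>D = d/dx\<close>. Such a form is
  regular at \<open>P\<close> iff it is in the \<open>P\<close>-module generated by the \<open>dh\<close> with \<open>h\<close> in \<open>P\<close>.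
  The set below consists of the \<open>f\<close> such that \<open>f dx\<close> is regular on \<open>X\<close>.
\<close>
definition regular_forms :: "('K::field \<Rightarrow> 'K) \<Rightarrow> 'K set set \<Rightarrow> 'K set" where
  "regular_forms D X =
     {f. \<forall>P\<in>X. \<exists>S. finite S \<and> S \<subseteq> P \<times> P \<and> f = (\<Sum>(a, h)\<in>S. a * D h)}"


section \<open>Rational functions of \<open>s\<close> over the function field\<close>

type_synonym 'a ratfun = "'a poly fract"

definition of_poly :: "'a::field poly \<Rightarrow> 'a ratfun" where
  "of_poly q = Fraction_Field.Fract q 1"

definition const_rf :: "'a::field \<Rightarrow> 'a ratfun" where
  "const_rf c = of_poly [:c:]"

definition s_var :: "'a::field ratfun" where
  "s_var = of_poly [:0, 1:]"

text \<open>The extension of a derivation \<open>D\<close> of \<open>'a\<close> to \<open>'a(s)\<close> which kills \<open>s\<close>.\<close>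
definition deriv_rf :: "('a::field \<Rightarrow> 'a) \<Rightarrow> 'a ratfun \<Rightarrow> 'a ratfun" where
  "deriv_rf D f = (THE g. \<exists>a b. b \<noteq> 0 \<and> f = Fraction_Field.Fract a b \<and>
     g = Fraction_Field.Fract (map_poly D a * b - a * map_poly D b) (b\<^sup>2))"

definition regular_at_inf :: "'a::field ratfun \<Rightarrow> bool" where
  "regular_at_inf f \<longleftrightarrow> (\<exists>a b. b \<noteq> 0 \<and> f = Fraction_Field.Fract a b \<and> degree a \<le> degree b)"

definition value_at_inf :: "'a::field ratfun \<Rightarrow> 'a" where
  "value_at_inf f = (THE c. \<exists>a b. b \<noteq> 0 \<and> f = Fraction_Field.Fract a b \<and> degree a \<le> degree b \<and>
     c = coeff a (degree b) / lead_coeff b)"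

definition regular_at_0 :: "'a::field ratfun \<Rightarrow> bool" where
  "regular_at_0 f \<longleftrightarrow> (\<exists>a b. poly b 0 \<noteq> 0 \<and> f = Fraction_Field.Fract a b)"

definition value_at_0 :: "'a::field ratfun \<Rightarrow> 'a" where
  "value_at_0 f = (THE c. \<exists>a b. poly b 0 \<noteq> 0 \<and> f = Fraction_Field.Fract a b \<and>
     c = poly a 0 / poly b 0)"

text \<open>The ring \<open>k(s)[X]\<close>, the base change to \<open>k(s)\<close> of the ring of regular functions on \<open>X\<close>.\<close>
definition regular_functions_rf :: "('k::field \<Rightarrow> 'K::field) \<Rightarrow> 'K set set \<Rightarrow> 'K ratfun set" where
  "regular_functions_rf \<iota> X =
     {Fraction_Field.Fract a (map_poly \<iota> q) | a q.
        q \<noteq> 0 \<and> (\<forall>i. coeff a i \<in> regular_functions X)}"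

text \<open>The definite descriptions above are well defined:\<close>

lemma deriv_rf_Fract:
  assumes D: "derivation_over \<iota> D" and b: "b \<noteq> 0"
  shows "deriv_rf D (Fraction_Field.Fract a b) =
           Fraction_Field.Fract (map_poly D a * b - a * map_poly D b) (b\<^sup>2)"
proof -
  have add: "D (x + y) = D x + D y" and mult: "D (x * y) = D x * y + x * D y" for x y
    using D by (auto simp: derivation_over_def)
  have D0: "D 0 = 0" using add[of 0 0] by (metis add_cancel_right_right add_0)
  have Dsum: "D (\<Sum>i\<in>A. f i) = (\<Sum>i\<in>A. D (f i))" for f :: "nat \<Rightarrow> _" and A
    by (induction A rule: infinite_finite_induct) (auto simp: add D0)
  let ?d = "map_poly D"
  have dm: "?d (u * v) = ?d u * v + u * ?d v" for u v
    by (rule poly_eqI) (simp add: coeff_map_poly D0 coeff_mult Dsum mult sum.distrib)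
  have wd: "Fraction_Field.Fract (?d a' * b' - a' * ?d b') (b'\<^sup>2) =
        Fraction_Field.Fract (?d a * b - a * ?d b) (b\<^sup>2)"
    if b': "b' \<noteq> 0" and e: "Fraction_Field.Fract a b = Fraction_Field.Fract a' b'" for a' b'
  proof -
    have 1: "a * b' = a' * b" using e b b' by (simp add: eq_fract)
    have "?d (a * b') = ?d (a' * b)" by (simp add: 1)
    then have 2: "?d a * b' + a * ?d b' = ?d a' * b + a' * ?d b" by (simp add: dm)
    have "(?d a' * b' - a' * ?d b') * b\<^sup>2 = (?d a * b - a * ?d b) * b'\<^sup>2"
    proof -
      have "(?d a' * b' - a' * ?d b') * b\<^sup>2 = b * b' * (?d a' * b) - (a' * b) * (b * ?d b')"
        by (simp add: algebra_simps power2_eq_square)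
      also have "?d a' * b = ?d a * b' + a * ?d b' - a' * ?d b"
        using 2 by (simp add: algebra_simps)
      also have "b * b' * \<dots> - (a' * b) * (b * ?d b') =
          b * b' * b' * ?d a + (a * b') * (b * ?d b') - (a' * b) * (b' * ?d b)
            - (a' * b) * (b * ?d b')"
        by (simp add: algebra_simps)
      also have "\<dots> = (?d a * b - a * ?d b) * b'\<^sup>2"
        unfolding 1[symmetric] by (simp add: algebra_simps power2_eq_square)
      finally show ?thesis .
    qed
    then show ?thesis using b b' by (simp add: eq_fract)
  qed
  show ?thesis unfolding deriv_rf_def
    by (rule the_equality) (use b wd in blast)+
qed

lemma value_at_inf_Fract:
  assumes b: "b \<noteq> 0" and d: "degree a \<le> degree b"
  shows "value_at_inf (Fraction_Field.Fract a b) = coeff a (degree b) / lead_coeff b"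
proof -
  have "coeff a' (degree b') / lead_coeff b' = coeff a (degree b) / lead_coeff b"
    if b': "b' \<noteq> 0" and d': "degree a' \<le> degree b'"
      and e: "Fraction_Field.Fract a b = Fraction_Field.Fract a' b'" for a' b'
  proof -
    have top: "coeff (u * v) (degree w + degree v) = coeff u (degree w) * lead_coeff v"
      if uw: "degree u \<le> degree w" for u v w :: "'a poly"
    proof (cases "degree u = degree w")
      case True
      then show ?thesis using coeff_mult_degree_sum[of u v] by simp
    next
      case False
      then have lt: "degree u < degree w" using uw by simp
      have "degree (u * v) < degree w + degree v"
        using degree_mult_le[of u v] lt by linarith
      then show ?thesis using lt by (simp add: coeff_eq_0)
    qed
    have "a * b' = a' * b" using e b b' by (simp add: eq_fract)
    then have "coeff a (degree b) * lead_coeff b' = coeff a' (degree b') * lead_coeff b"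
      using top[OF d, of b'] top[OF d', of b] by (simp add: add.commute)
    then show ?thesis using b b' by (simp add: field_simps)
  qed
  then show ?thesis unfolding value_at_inf_def
    by (intro the_equality) (use b d in blast)+
qed

lemma value_at_0_Fract:
  assumes b: "poly b 0 \<noteq> 0"
  shows "value_at_0 (Fraction_Field.Fract a b) = poly a 0 / poly b 0"
proof -
  have "poly a' 0 / poly b' 0 = poly a 0 / poly b 0"
    if b': "poly b' 0 \<noteq> 0" and e: "Fraction_Field.Fract a b = Fraction_Field.Fract a' b'" for a' b'
  proof -
    have "b \<noteq> 0" "b' \<noteq> 0" using b b' by auto
    then have "a * b' = a' * b" using e by (simp add: eq_fract)
    then have "poly a 0 * poly b' 0 = poly a' 0 * poly b 0" by (metis poly_mult)
    then show ?thesis using b b' by (simp add: field_simps)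
  qed
  then show ?thesis unfolding value_at_0_def
    by (intro the_equality) (use b in blast)+
qed


section \<open>Connections\<close>

text \<open>
  The covariant derivative \<open>\<partial> - M\<close> along \<open>\<partial> = D\<close> of the connection \<open>d - M dx\<close>, acting on
  column vectors over \<open>'K(s)\<close>.
\<close>
definition nabla :: "('K::field \<Rightarrow> 'K) \<Rightarrow> 'K ratfun mat \<Rightarrow> 'K ratfun vec \<Rightarrow> 'K ratfun vec" where
  "nabla D M v = map_vec (deriv_rf D) v - M *\<^sub>v v"

definition mutually_inverse :: "nat \<Rightarrow> 'a::comm_ring_1 mat \<Rightarrow> 'a mat \<Rightarrow> bool" where
  "mutually_inverse N G H \<longleftrightarrow>
     G \<in> carrier_mat N N \<and> H \<in> carrier_mat N N \<and> G * H = 1\<^sub>m N \<and> H * G = 1\<^sub>m N"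

text \<open>\<open>(\<partial> - M') \<circ> G = G \<circ> (\<partial> - M)\<close>\<close>
definition intertwines ::
  "('K::field \<Rightarrow> 'K) \<Rightarrow> nat \<Rightarrow> 'K ratfun mat \<Rightarrow> 'K ratfun mat \<Rightarrow> 'K ratfun mat \<Rightarrow> bool" where
  "intertwines D N G M M' \<longleftrightarrow>
     (\<forall>v \<in> carrier_vec N. nabla D M' (G *\<^sub>v v) = G *\<^sub>v nabla D M v)"

definition gauge_equivalent ::
  "('K::field \<Rightarrow> 'K) \<Rightarrow> nat \<Rightarrow> 'K ratfun mat \<Rightarrow> 'K ratfun mat \<Rightarrow> bool" where
  "gauge_equivalent D N M M' \<longleftrightarrow> (\<exists>G H. mutually_inverse N G H \<and> intertwines D N G M M')"

text \<open>
  A polynomial family \<open>\<nabla>(s) = d - B(s)\<close> on the trivial bundle of rank \<open>N\<close> is given by a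
  matrix of polynomials in \<open>s\<close>, whose coefficients are regular 1-forms, trivialized by \<open>dx\<close>.
\<close>
definition polynomial_family :: "('K::field \<Rightarrow> 'K) \<Rightarrow> 'K set set \<Rightarrow> nat \<Rightarrow> 'K poly mat \<Rightarrow> bool" where
  "polynomial_family D X N B \<longleftrightarrow>
     B \<in> carrier_mat N N \<and> (\<forall>i<N. \<forall>j<N. \<forall>n. coeff (B $$ (i, j)) n \<in> regular_forms D X)"

definition rf_mat :: "'K::field poly mat \<Rightarrow> 'K ratfun mat" where
  "rf_mat B = map_mat of_poly B"

definition shift :: "'K::field poly mat \<Rightarrow> 'K poly mat" where
  "shift B = map_mat (\<lambda>q. q \<circ>\<^sub>p [:1, 1:]) B"

definition periodic ::
  "('k::field \<Rightarrow> 'K::field) \<Rightarrow> ('K \<Rightarrow> 'K) \<Rightarrow> 'K set set \<Rightarrow> nat \<Rightarrow> 'K poly mat \<Rightarrow> bool" where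
  "periodic \<iota> D X N B \<longleftrightarrow>
     (\<exists>A A'. mutually_inverse N A A' \<and>
        elements_mat A \<subseteq> regular_functions_rf \<iota> X \<and> elements_mat A' \<subseteq> regular_functions_rf \<iota> X \<and>
        intertwines D N A (rf_mat B) (rf_mat (shift B)))"

text \<open>\<open>\<nabla>(s)\<close> is a pseudo-pencil, witnessed by the gauge equivalent form \<open>d - s Binf_s\<close>.\<close>
definition pseudo_pencil ::
  "('K::field \<Rightarrow> 'K) \<Rightarrow> nat \<Rightarrow> 'K poly mat \<Rightarrow> 'K ratfun mat \<Rightarrow> bool" where
  "pseudo_pencil D N B Binf_s \<longleftrightarrow>
     Binf_s \<in> carrier_mat N N \<and> (\<forall>f\<in>elements_mat Binf_s. regular_at_inf f) \<and>
     gauge_equivalent D N (rf_mat B) (s_var \<cdot>\<^sub>m Binf_s)"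

text \<open>\<open>\<nabla>(s)\<close> is trivializable at \<open>0\<close>, witnessed by the gauge equivalent form \<open>d - s Bzero_s\<close>.\<close>
definition trivializable_at_0 ::
  "('K::field \<Rightarrow> 'K) \<Rightarrow> nat \<Rightarrow> 'K poly mat \<Rightarrow> 'K ratfun mat \<Rightarrow> bool" where
  "trivializable_at_0 D N B Bzero_s \<longleftrightarrow>
     Bzero_s \<in> carrier_mat N N \<and> (\<forall>f\<in>elements_mat Bzero_s. regular_at_0 f) \<and>
     gauge_equivalent D N (rf_mat B) (s_var \<cdot>\<^sub>m Bzero_s)"

text \<open>
  The matrix of the operator \<open>(\<partial> - B(s))^p\<close>; this operator is linear over \<open>'K(s)\<close> since
  \<open>(d/dx)^p = 0\<close> in characteristic \<open>p\<close>.
\<close>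
definition p_curvature :: "('K::field \<Rightarrow> 'K) \<Rightarrow> nat \<Rightarrow> nat \<Rightarrow> 'K poly mat \<Rightarrow> 'K ratfun mat" where
  "p_curvature D p N B =
     mat N N (\<lambda>(i, j). ((nabla D (rf_mat B) ^^ p) (unit_vec N j)) $ i)"

definition frobenius_twist :: "nat \<Rightarrow> 'K::field mat \<Rightarrow> 'K mat" where
  "frobenius_twist p M = map_mat (\<lambda>z. z ^ p) M"

definition isospectral :: "'a::comm_ring_1 mat \<Rightarrow> 'a mat \<Rightarrow> bool" where
  "isospectral M M' \<longleftrightarrow> char_poly M = char_poly M'"

end

theory Submission
  imports Defs
begin

text \<open>
  Write \<open>C(s)\<close> for the \<open>p\<close>-curvature and \<open>e\<^sub>i(s)\<close> for the coefficient of \<open>\<lambda>\<close> to the power \<open>N - i\<close>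
  in its characteristic polynomial. Three properties of \<open>e\<^sub>i\<close> determine it up to one constant.

  First, \<open>e\<^sub>i\<close> is a polynomial in \<open>s\<close>, since \<open>B(s)\<close> is, and \<open>e\<^sub>i(s + 1) = e\<^sub>i(s)\<close>, since \<open>\<nabla>(s + 1)\<close> and
  \<open>\<nabla>(s)\<close> are gauge equivalent. Secondly, after the gauge transformation to \<open>d - s B\<^sub>\<infinity>(s)\<close> each of the
  \<open>p\<close> covariant derivatives contributes at most one factor \<open>s\<close>, and differentiation contributes none;
  so the leading part of \<open>C(s)\<close> at infinity is the \<open>p\<close>-th power of \<open>- s B\<^sub>\<infinity>\<close>
  (\<open>covariant_power_at_inf\<close>). Hence \<open>e\<^sub>i\<close> has degree at most \<open>p i\<close>, and its coefficient there comes
  from the matrix power of \<open>- B\<^sub>\<infinity>\<close>. Thirdly, after the transformation to \<open>d - s B\<^sub>0(s)\<close> consider the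
  images of constant vectors modulo \<open>s\<^sup>2\<close>: the derivative that acts first contributes \<open>- s B\<^sub>0\<close>, and the
  other \<open>p - 1\<close> differentiate the result (\<open>covariant_power_at_0\<close>). Hence \<open>s\<close> to the power \<open>i\<close>
  divides \<open>e\<^sub>i\<close>, and the coefficient there comes from the \<open>(p - 1)\<close>-st derivative of \<open>- B\<^sub>0\<close>.

  A shift-invariant polynomial that vanishes at \<open>0\<close> vanishes on the prime field, so it is divisible by
  \<open>s - s\<^sup>p\<close>. Iterating this \<open>i\<close> times uses up the whole degree, and \<open>e\<^sub>i\<close> is a constant times the
  \<open>i\<close>-th power of \<open>s - s\<^sup>p\<close> (\<open>shift_invariant_poly_eq\<close>). The constant is read off at both ends, and
  this yields all three assertions, because \<open>B\<^sub>\<infinity>\<close> to the power \<open>p\<close> and the Frobenius twist of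
  \<open>B\<^sub>\<infinity>\<close> are isospectral (\<open>char_poly_pow_CHAR\<close>, \<open>char_poly_frobenius_twist\<close>).

  All this needs that \<open>p\<close>-curvatures of gauge equivalent connections are conjugate, which in turn
  rests on \<open>\<partial>\<close> having vanishing \<open>p\<close>-th power on the function field
  (\<open>coordinate_derivation_funpow_CHAR\<close>).
\<close>

section \<open>Rings of prime characteristic\<close>

text \<open>
  The binomial theorem for an additive operator \<open>T\<close> which acts on a family \<open>a\<^sub>j\<^sub>m\<close> as a sum of
  two commuting index shifts: \<open>b n j m\<close> stands for \<open>T\<close> iterated \<open>n\<close> times on \<open>a\<^sub>j\<^sub>m\<close>, or for one
  entry of it if the values are vectors or matrices. The Leibniz rule for derivations, the one for
  connections and the power of a sum of two commuting matrices are all of this form.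
\<close>
lemma binomial_recursion:
  fixes b :: "nat \<Rightarrow> nat \<Rightarrow> nat \<Rightarrow> 'a::comm_ring_1"
  assumes step: "\<And>n j m. b (Suc n) j m = b n (Suc j) m + b n j (Suc m)"
  shows "b n j m = (\<Sum>k\<le>n. of_nat (n choose k) * b 0 (j + k) (m + (n - k)))"
proof (induction n arbitrary: j m)
  case 0
  show ?case by simp
next
  case (Suc n)
  let ?c = "\<lambda>k. b 0 (j + k) (m + (Suc n - k))"
  have 1: "b n (Suc j) m = (\<Sum>k\<le>n. of_nat (n choose k) * ?c (Suc k))"
    by (subst Suc.IH) simp
  have "b n j (Suc m) = (\<Sum>k\<le>n. of_nat (n choose k) * ?c k)"
    by (subst Suc.IH) (rule sum.cong, auto simp: Suc_diff_le)
  also have "\<dots> = (\<Sum>k\<le>Suc n. of_nat (n choose k) * ?c k)" by (simp add: binomial_eq_0)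
  also have "\<dots> = ?c 0 + (\<Sum>k\<le>n. of_nat (n choose Suc k) * ?c (Suc k))"
    by (subst sum.atMost_Suc_shift) simp
  finally have 2: "b n j (Suc m) = \<dots>" .
  have "(\<Sum>k\<le>Suc n. of_nat (Suc n choose k) * ?c k) =
      ?c 0 + (\<Sum>k\<le>n. of_nat (Suc n choose Suc k) * ?c (Suc k))"
    by (subst sum.atMost_Suc_shift) simp
  also have "\<dots> = ?c 0 + (\<Sum>k\<le>n. of_nat (n choose k) * ?c (Suc k) +
      of_nat (n choose Suc k) * ?c (Suc k))"
    by (simp add: algebra_simps)
  also have "\<dots> = b (Suc n) j m"
    by (subst step, subst 1, subst 2, simp only: sum.distrib add_ac)
  finally show ?case by simp
qed

text \<open>
  For the exponent \<open>p\<close> the inner binomial coefficients vanish, and only the two pure terms survive.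
\<close>
lemma binomial_recursion_CHAR:
  fixes b :: "nat \<Rightarrow> nat \<Rightarrow> nat \<Rightarrow> 'a::comm_ring_1"
  assumes step: "\<And>n j m. b (Suc n) j m = b n (Suc j) m + b n j (Suc m)"
    and p: "prime p" "CHAR('a) = p"
  shows "b p 0 0 = b 0 p 0 + b 0 0 p"
proof -
  have "b p 0 0 = (\<Sum>k\<le>p. of_nat (p choose k) * b 0 k (p - k))"
    using binomial_recursion[of b p 0 0] step by simp
  also have "\<dots> = (\<Sum>k\<in>{0, p}. of_nat (p choose k) * b 0 k (p - k))"
  proof (intro sum.mono_neutral_right ballI)
    fix k assume "k \<in> {..p} - {0, p}"
    then have "p dvd (p choose k)"
      using p(1) by (intro dvd_choose_prime) auto
    then have "of_nat (p choose k) = (0 :: 'a)" using p(2) by (simp add: of_nat_eq_0_iff_char_dvd)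
    then show "of_nat (p choose k) * b 0 k (p - k) = 0" by simp
  qed auto
  also have "\<dots> = b 0 p 0 + b 0 0 p" using p(1) prime_gt_0_nat[of p] by (simp add: add.commute)
  finally show ?thesis .
qed

text \<open>
  The freshman's dream for polynomials separates into the Frobenius map on the coefficients and
  the substitution of the \<open>p\<close>-th power of the variable.
\<close>
lemma power_CHAR_poly:
  fixes f :: "'a::comm_ring_1 poly"
  assumes p: "prime p" "CHAR('a) = p"
  shows "f ^ p = map_poly (\<lambda>c. c ^ p) f \<circ>\<^sub>p monom 1 p"
proof (induction f)
  case 0
  then show ?case using prime_gt_0_nat[OF p(1)] by (simp add: power_0_left)
next
  case (pCons a f)
  have p0: "p > 0" using prime_gt_0_nat[OF p(1)] .
  have "pCons a f ^ p = ([:a:] + monom 1 1 * f) ^ p"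
    by (simp add: monom_altdef)
  also have "\<dots> = [:a:] ^ p + (monom 1 1 * f) ^ p"
    using p by (intro freshmans_dream) auto
  also have "\<dots> = [:a ^ p:] + monom 1 p * f ^ p"
    by (simp add: power_mult_distrib monom_power poly_const_pow)
  also have "f ^ p = map_poly (\<lambda>c. c ^ p) f \<circ>\<^sub>p monom 1 p" by (rule pCons.IH)
  also have "[:a ^ p:] + monom 1 p * \<dots> = map_poly (\<lambda>c. c ^ p) (pCons a f) \<circ>\<^sub>p monom 1 p"
    using p0 pCons.hyps by (simp add: map_poly_pCons pcompose_pCons power_0_left)
  finally show ?case .
qed

lemma coeff_pcompose_monom:
  fixes f :: "'a::comm_ring_1 poly"
  assumes "p > 0"
  shows "coeff (f \<circ>\<^sub>p monom 1 p) n = (if p dvd n then coeff f (n div p) else 0)"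
proof (induction f arbitrary: n)
  case 0
  then show ?case by simp
next
  case (pCons a f)
  have "coeff (pCons a f \<circ>\<^sub>p monom 1 p) n =
      coeff [:a:] n + (if n < p then 0 else coeff (f \<circ>\<^sub>p monom 1 p) (n - p))"
    by (simp add: pcompose_pCons coeff_monom_mult)
  also have "\<dots> = (if p dvd n then coeff (pCons a f) (n div p) else 0)"
  proof (cases "n < p")
    case True
    then show ?thesis using assms by (cases "n = 0") (auto simp: coeff_pCons split: nat.splits dest: dvd_imp_le)
  next
    case False
    then have "n div p = Suc ((n - p) div p)" "p dvd n \<longleftrightarrow> p dvd n - p" "n \<noteq> 0"
      using assms by (auto simp: le_div_geq dvd_minus_self)
    then show ?thesis using False pCons.IH[of "n - p"]
      by (auto simp: coeff_pCons split: nat.splits)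
  qed
  finally show ?case .
qed

text \<open>
  A vanishing derivative leaves only exponents divisible by \<open>p\<close>, so taking \<open>p\<close>-th roots of the
  coefficients gives a \<open>p\<close>-th root of the polynomial.
\<close>
lemma exists_CHAR_root_poly:
  fixes f :: "'a::idom poly"
  assumes p: "prime p" "CHAR('a) = p"
    and d: "pderiv f = 0" and r: "\<And>i. \<exists>g. g ^ p = coeff f i"
  shows "\<exists>h. h ^ p = f \<and> (\<forall>i. coeff h i ^ p = coeff f (p * i))"
proof -
  have p0: "p > 0" using prime_gt_0_nat[OF p(1)] .
  obtain g where g: "\<And>i. g i ^ p = coeff f i" using r by metis
  define h where "h = (\<Sum>i\<le>degree f. monom (g (p * i)) i)"
  have ch: "coeff h i = (if i \<le> degree f then g (p * i) else 0)" for i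
    by (simp add: h_def coeff_sum)
  have c: "coeff h i ^ p = coeff f (p * i)" for i
  proof (cases "i \<le> degree f")
    case False
    moreover have "i \<le> p * i" using p0 by simp
    ultimately have "degree f < p * i" by linarith
    then show ?thesis using False p0 by (simp add: ch coeff_eq_0 power_0_left)
  qed (simp add: ch g)
  have "h ^ p = f"
  proof (rule poly_eqI)
    fix n
    have "coeff (h ^ p) n = (if p dvd n then coeff h (n div p) ^ p else 0)"
      using p0 by (simp add: power_CHAR_poly[OF p] coeff_pcompose_monom coeff_map_poly power_0_left)
    also have "\<dots> = coeff f n"
    proof (cases "p dvd n")
      case False
      then obtain m where m: "n = Suc m" by (cases n) auto
      have "of_nat n * coeff f n = 0"
        using arg_cong[OF d, of "\<lambda>q. coeff q m"] by (simp add: coeff_pderiv m)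
      moreover have "of_nat n \<noteq> (0 :: 'a)"
        using False p(2) by (simp add: of_nat_eq_0_iff_char_dvd)
      ultimately show ?thesis using False by simp
    qed (simp add: c)
    finally show "coeff (h ^ p) n = coeff f n" .
  qed
  with c show ?thesis by blast
qed

section \<open>Derivations\<close>

locale derivation =
  fixes d :: "'a::comm_ring_1 \<Rightarrow> 'a"
  assumes add: "d (a + b) = d a + d b"
    and mult: "d (a * b) = d a * b + a * d b"
begin

lemma zero [simp]: "d 0 = 0"
  using add[of 0 0] by simp

lemma one [simp]: "d 1 = 0"
  using mult[of 1 1] by simp

lemma minus: "d (- a) = - d a"
  using add[of a "- a"] by (simp add: eq_neg_iff_add_eq_0 add.commute)

lemma sum: "d (\<Sum>i\<in>A. f i) = (\<Sum>i\<in>A. d (f i))"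
  by (induction A rule: infinite_finite_induct) (auto simp: add)

lemma funpow_add: "(d ^^ n) (a + b) = (d ^^ n) a + (d ^^ n) b"
  by (induction n) (auto simp: add)

lemma funpow_zero [simp]: "(d ^^ n) 0 = 0"
  by (induction n) auto

text \<open>
  All mixed terms of the Leibniz rule for the \<open>p\<close>-th iterate have coefficients divisible by \<open>p\<close>.
\<close>
lemma funpow_CHAR:
  assumes p: "prime p" "CHAR('a) = p"
  shows "derivation (d ^^ p)"
proof
  fix a b
  let ?b = "\<lambda>n j m. (d ^^ n) ((d ^^ j) a * (d ^^ m) b)"
  have "?b (Suc n) j m = ?b n (Suc j) m + ?b n j (Suc m)" for n j m
    by (simp add: funpow_swap1 mult funpow_add)
  from binomial_recursion_CHAR[of ?b, OF this p]
  show "(d ^^ p) (a * b) = (d ^^ p) a * b + a * (d ^^ p) b" by simp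
qed (rule funpow_add)

lemma map_poly_derivation: "derivation (map_poly d)"
  by standard (auto intro!: poly_eqI simp: coeff_map_poly add coeff_mult sum mult sum.distrib)

end

lemma poly_chain_rule:
  fixes d :: "'a::idom \<Rightarrow> 'a"
  assumes "derivation d"
  shows "d (poly q z) = poly (map_poly d q) z + poly (pderiv q) z * d z"
proof -
  interpret derivation d by fact
  show ?thesis
  proof (induction q)
    case (pCons a q)
    then show ?case
      by (cases "q = 0") (simp_all add: map_poly_pCons pderiv_pCons add mult algebra_simps)
  qed simp
qed

section \<open>The \<open>p\<close>-th power of \<open>d/dx\<close>\<close>

lemma CHAR_field_hom:
  fixes \<iota> :: "'k::field \<Rightarrow> 'K::field"
  assumes "field_hom \<iota>"
  shows "CHAR('K) = CHAR('k)"
proof -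
  interpret field_hom \<iota> by fact
  show ?thesis
  proof (rule CHAR_eqI)
    show "of_nat CHAR('k) = (0 :: 'K)" by (simp flip: hom_of_nat)
    fix x :: nat assume "of_nat x = (0 :: 'K)"
    then have "\<iota> (of_nat x) = 0" by (simp add: hom_of_nat)
    then show "CHAR('k) dvd x" by (simp add: of_nat_eq_0_iff_char_dvd)
  qed
qed

lemma derivation_over_imp_derivation: "derivation_over \<iota> D \<Longrightarrow> derivation D"
  by (simp add: derivation_over_def derivation_def)

text \<open>
  The value at \<open>(y, z)\<close> of a bivariate polynomial whose outer variable is evaluated at \<open>z\<close>, as in
  the notion of algebraic dependence.
\<close>
definition eval2 :: "('k::field \<Rightarrow> 'K::field) \<Rightarrow> 'K \<Rightarrow> 'K \<Rightarrow> 'k poly poly \<Rightarrow> 'K" where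
  "eval2 \<iota> y z F = poly (map_poly (\<lambda>q. poly (map_poly \<iota> q) y) F) z"

lemma eval2_hom:
  assumes "field_hom \<iota>"
  shows "comm_ring_hom (eval2 \<iota> y z)"
proof -
  interpret field_hom \<iota> by fact
  interpret mp: map_poly_comm_ring_hom \<iota> ..
  interpret e: comm_ring_hom "\<lambda>q. poly (map_poly \<iota> q) y"
    by standard (simp_all add: hom_distribs)
  interpret me: map_poly_comm_ring_hom "\<lambda>q. poly (map_poly \<iota> q) y" ..
  show ?thesis unfolding eval2_def
    by standard (simp_all add: hom_distribs)
qed

text \<open>
  The chain rule in two variables: \<open>map_poly pderiv\<close> is the partial derivative in the inner
  variable, \<open>pderiv\<close> the one in the outer variable.
\<close>
lemma derivation_eval2:
  assumes \<iota>: "field_hom \<iota>" and E: "derivation_over \<iota> E"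
  shows "E (eval2 \<iota> y z F) =
    eval2 \<iota> y z (map_poly pderiv F) * E y + eval2 \<iota> y z (pderiv F) * E z"
proof -
  interpret field_hom \<iota> by fact
  interpret d: derivation E using E by (rule derivation_over_imp_derivation)
  interpret mp: map_poly_comm_ring_hom \<iota> ..
  interpret e: comm_ring_hom "\<lambda>q. poly (map_poly \<iota> q) y"
    by standard (simp_all add: hom_distribs)
  interpret e': idom_hom "\<lambda>q. poly (map_poly \<iota> q) y" ..
  have c: "E (\<iota> c) = 0" for c using E by (simp add: derivation_over_def)
  have 1: "E (poly (map_poly \<iota> q) y) = poly (map_poly \<iota> (pderiv q)) y * E y" for q
  proof -
    have "map_poly E (map_poly \<iota> q) = 0" by (rule poly_eqI) (simp add: coeff_map_poly c)
    then show ?thesis using poly_chain_rule[OF d.derivation_axioms, of "map_poly \<iota> q" y]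
      by (simp add: map_poly_pderiv)
  qed
  have "poly (map_poly E (map_poly (\<lambda>q. poly (map_poly \<iota> q) y) F)) z =
     eval2 \<iota> y z (map_poly pderiv F) * E y"
  proof -
    have "map_poly E (map_poly (\<lambda>q. poly (map_poly \<iota> q) y) F) =
       Polynomial.smult (E y) (map_poly (\<lambda>q. poly (map_poly \<iota> q) y) (map_poly pderiv F))"
      by (rule poly_eqI) (simp add: coeff_map_poly 1)
    then show ?thesis by (simp add: eval2_def)
  qed
  then show ?thesis
    using poly_chain_rule[OF d.derivation_axioms, of "map_poly (\<lambda>q. poly (map_poly \<iota> q) y) F" z]
    by (simp add: eval2_def e'.map_poly_pderiv)
qed

lemma degree_power_pos:
  fixes q :: "'a::idom poly"
  assumes "n > 0"
  shows "degree (q ^ n) = n * degree q"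
  using assms by (cases "q = 0") (auto simp: degree_power_eq power_0_left)

text \<open>
  A second derivation that kills \<open>y\<close> but not \<open>z\<close> forces every relation \<open>F(y, z) = 0\<close> to be trivial,
  by descent on the degrees of \<open>F\<close>. Applying \<open>E\<close> to the relation shows that the outer partial
  derivative of \<open>F\<close> is a relation too, and applying \<open>D\<close> then shows this for the inner one. Both are
  smaller than \<open>F\<close>, hence zero. But then \<open>F\<close> is a \<open>p\<close>-th power because the base field is perfect,
  and its root is again a smaller relation.
\<close>
lemma no_inseparable_relation:
  fixes \<iota> :: "'k::alg_closed_field \<Rightarrow> 'K::field"
  assumes \<iota>: "field_hom \<iota>" and p: "prime p" "CHAR('k) = p"
    and D: "derivation_over \<iota> D" "D y \<noteq> 0"
    and E: "derivation_over \<iota> E" "E y = 0" "E z \<noteq> 0"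
  shows "eval2 \<iota> y z F = 0 \<Longrightarrow> F = 0"
proof -
  interpret ev: comm_ring_hom "eval2 \<iota> y z" using \<iota> by (rule eval2_hom)
  interpret field_hom \<iota> by fact
  have p1: "p > 1" using p(1) by (rule prime_gt_1_nat)
  \<comment> \<open>The descent is on \<open>a + b\<close>, where \<open>a\<close> and \<open>b\<close> bound the outer and the inner degree.
    Each step lowers one bound, or divides both by \<open>p\<close>.\<close>
  have bounded: "eval2 \<iota> y z F = 0 \<Longrightarrow> degree F \<le> a \<Longrightarrow> (\<And>i. degree (coeff F i) \<le> b) \<Longrightarrow>
      n = a + b \<Longrightarrow> F = 0" for n a b F
  proof (induction n arbitrary: a b F rule: less_induct)
    case (less n)
    note dega = less.prems(2) and degb = less.prems(3)
    have *: "eval2 \<iota> y z (pderiv F) = 0"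
      using derivation_eval2[OF \<iota> E(1), of y z F] less.prems(1) E
      by (simp add: derivation_over_imp_derivation[THEN derivation.zero])
    have dZ: "pderiv F = 0"
    proof (cases "a = 0")
      case True
      then show ?thesis using dega by (auto elim!: degree_eq_zeroE)
    next
      case False
      have "degree (coeff (pderiv F) i) \<le> b" for i
        unfolding coeff_pderiv using degb[of "Suc i"] degree_mult_le[of "of_nat (Suc i)" "coeff F (Suc i)"]
        by (simp del: of_nat_Suc)
      moreover have "degree (pderiv F) \<le> a - 1"
        using degree_pderiv_le[of F] dega by linarith
      ultimately show ?thesis using * False less.prems(4)
        by (intro less.IH[of "a - 1 + b" _ "a - 1" b]) auto
    qed
    have **: "eval2 \<iota> y z (map_poly pderiv F) = 0"
      using derivation_eval2[OF \<iota> D(1), of y z F] less.prems(1) D *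
      by (simp add: derivation_over_imp_derivation[THEN derivation.zero])
    have dY: "pderiv (coeff F i) = 0" for i
    proof (cases "b = 0")
      case True
      then show ?thesis using degb[of i] by (auto elim!: degree_eq_zeroE)
    next
      case False
      have "degree (coeff (map_poly pderiv F) i) \<le> b - 1" for i
        using degb[of i] degree_pderiv_le[of "coeff F i"] by (simp add: coeff_map_poly)
      moreover have "degree (map_poly pderiv F) \<le> a"
        using degree_map_poly_le[of pderiv F] dega by linarith
      ultimately have "map_poly pderiv F = 0" using ** False less.prems(4)
        by (intro less.IH[of "a + (b - 1)" _ a "b - 1"]) auto
      then have "coeff (map_poly pderiv F) i = 0" by simp
      then show ?thesis by (simp add: coeff_map_poly)
    qed
    have "\<exists>g. g ^ p = coeff F i" for i
    proof -
      have "\<exists>g. g ^ p = coeff (coeff F i) j" for j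
        using nth_root_exists[of p "coeff (coeff F i) j"] p1 by auto
      then show ?thesis using exists_CHAR_root_poly[OF p dY] by blast
    qed
    then obtain h where h: "h ^ p = F" "\<And>i. coeff h i ^ p = coeff F (p * i)"
      using exists_CHAR_root_poly[OF p(1) _ dZ] p(2) by auto
    show ?case
    proof (cases "n = 0")
      case True
      then have "degree F = 0" "degree (coeff F 0) = 0" using less.prems(4) dega degb[of 0] by auto
      then obtain c where "F = [:[:c:]:]" by (metis coeff_pCons_0 degree_eq_zeroE)
      then show ?thesis using less.prems(1)
        by (cases "c = 0") (simp_all add: eval2_def map_poly_pCons)
    next
      case False
      have "eval2 \<iota> y z h ^ p = 0" using h(1) less.prems(1) by (simp flip: ev.hom_power)
      then have "eval2 \<iota> y z h = 0" by simp
      moreover have "p * degree h = degree F" using h(1) p1 degree_power_pos[of p h] by simp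
      then have "degree h \<le> a div p"
        using dega p1 by (metis div_le_mono nonzero_mult_div_cancel_left not_one_less_zero)
      moreover have "degree (coeff h i) \<le> b div p" for i
      proof -
        have "p * degree (coeff h i) = degree (coeff F (p * i))"
          using h(2)[of i] p1 degree_power_pos[of p "coeff h i"] by simp
        then show ?thesis
          using degb[of "p * i"] p1 by (metis div_le_mono nonzero_mult_div_cancel_left not_one_less_zero)
      qed
      moreover have "a div p + b div p < n"
        using False less.prems(4) p1 div_le_dividend[of a p] div_le_dividend[of b p]
          div_less_dividend[of p a] div_less_dividend[of p b]
        by (cases "a = 0") (auto intro!: add_less_le_mono)
      ultimately have "h = 0" by (intro less.IH) auto
      then show ?thesis using h(1) p1 by (auto simp: power_0_left)
    qed
  qed
  assume F: "eval2 \<iota> y z F = 0"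
  define b where "b = Max ((\<lambda>i. degree (coeff F i)) ` {..degree F})"
  have "degree (coeff F i) \<le> b" for i
    by (cases "i \<le> degree F") (auto simp: b_def coeff_eq_0)
  then show "F = 0" using bounded[OF F order.refl _ refl] by blast
qed

text \<open>
  In transcendence degree one, a derivation over the base field is determined by its value at a
  single element \<open>y\<close> on which some derivation does not vanish: such a \<open>y\<close> is separating.
\<close>
lemma derivation_eq_0:
  fixes \<iota> :: "'k::alg_closed_field \<Rightarrow> 'K::field"
  assumes \<iota>: "field_hom \<iota>" and p: "prime p" "CHAR('k) = p"
    and alg: "\<And>z. alg_dependent \<iota> y z"
    and D: "derivation_over \<iota> D" "D y \<noteq> 0"
    and E: "derivation_over \<iota> E" "E y = 0"
  shows "E z = 0"
proof (rule ccontr)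
  assume "E z \<noteq> 0"
  moreover obtain F where "F \<noteq> 0" "eval2 \<iota> y z F = 0"
    using alg[of z] by (auto simp: alg_dependent_def eval2_def)
  ultimately show False using no_inseparable_relation[OF \<iota> p D E] by blast
qed

text \<open>
  The \<open>p\<close>-th iterate of \<open>d/dx\<close> is a derivation that kills \<open>x\<close>, because \<open>p \<ge> 2\<close>. Hence it is zero.
\<close>
lemma coordinate_derivation_funpow_CHAR:
  fixes \<iota> :: "'k::alg_closed_field \<Rightarrow> 'K::field"
  assumes K: "function_field \<iota>" and p: "prime p" "CHAR('k) = p"
    and D: "coordinate_derivation \<iota> x D"
  shows "(D ^^ p) z = 0"
proof -
  have \<iota>: "field_hom \<iota>" and alg: "\<And>y z. alg_dependent \<iota> y z"
    using K by (auto simp: function_field_def)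
  have D': "derivation_over \<iota> D" "D x = 1" using D by (auto simp: coordinate_derivation_def)
  interpret derivation D using D'(1) by (rule derivation_over_imp_derivation)
  have "derivation (D ^^ p)" using p CHAR_field_hom[OF \<iota>] by (intro funpow_CHAR) auto
  moreover obtain m where m: "p = Suc (Suc m)"
    using prime_ge_2_nat[OF p(1)] by (metis add_2_eq_Suc le_Suc_ex)
  have "(D ^^ p) (\<iota> c) = 0" for c
    using D'(1) by (simp add: m funpow_Suc_right derivation_over_def del: funpow.simps)
  ultimately have "derivation_over \<iota> (D ^^ p)"
    by (simp add: derivation_over_def derivation_def)
  moreover have "(D ^^ p) x = 0"
    by (simp add: m funpow_Suc_right D'(2) del: funpow.simps)
  ultimately show ?thesis using derivation_eq_0[OF \<iota> p alg D'(1), where E = "D ^^ p" and y = x and z = z] D'(2) by simp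
qed

section \<open>Rational functions of \<open>s\<close>\<close>

lemma of_poly_hom: "inj_comm_ring_hom (of_poly :: 'a::field poly \<Rightarrow> _)"
  by standard (auto simp: of_poly_def Zero_fract_def One_fract_def eq_fract)

interpretation of_poly: inj_comm_ring_hom "of_poly :: 'a::field poly \<Rightarrow> 'a ratfun"
  by (rule of_poly_hom)

lemmas of_poly_distribs = of_poly.hom_add of_poly.hom_mult of_poly.hom_minus

lemma Fract_conv_of_poly: "b \<noteq> 0 \<Longrightarrow> Fraction_Field.Fract a b = of_poly a / of_poly b"
  by (simp add: of_poly_def)

lemma ratfun_cases:
  fixes f :: "'a::field ratfun"
  obtains a b where "b \<noteq> 0" "f = of_poly a / of_poly b"
  by (cases f) (auto simp: Fract_conv_of_poly)

lemma CHAR_ratfun: "CHAR('a::field ratfun) = CHAR('a)"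
proof (rule CHAR_eqI)
  show "of_nat CHAR('a) = (0 :: 'a ratfun)"
    by (metis of_poly.hom_of_nat of_poly.hom_zero of_nat_CHAR semiring_char_poly)
  fix n assume "of_nat n = (0 :: 'a ratfun)"
  then have "of_poly (of_nat n) = (0 :: 'a ratfun)" by (simp add: of_poly.hom_of_nat)
  then have "of_nat n = (0 :: 'a poly)" by simp
  then show "CHAR('a) dvd n" by (simp add: of_nat_eq_0_iff_char_dvd)
qed

lemma deriv_rf_quotient:
  assumes "derivation_over \<iota> D" "b \<noteq> 0"
  shows "deriv_rf D (of_poly a / of_poly b) =
    (of_poly (map_poly D a) * of_poly b - of_poly a * of_poly (map_poly D b)) / (of_poly b)\<^sup>2"
  using deriv_rf_Fract[OF assms, of a] assms(2)
  by (simp add: Fract_conv_of_poly of_poly_distribs power2_eq_square)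

lemma deriv_rf_of_poly:
  assumes "derivation_over \<iota> D"
  shows "deriv_rf D (of_poly a) = of_poly (map_poly D a)"
proof -
  interpret derivation D using assms by (rule derivation_over_imp_derivation)
  show ?thesis using deriv_rf_quotient[OF assms, of 1 a] by (simp add: map_poly_1)
qed

lemma derivation_deriv_rf:
  fixes D :: "'K::field \<Rightarrow> 'K"
  assumes D: "derivation_over \<iota> D"
  shows "derivation (deriv_rf D)"
proof -
  interpret derivation D using assms by (rule derivation_over_imp_derivation)
  interpret m: derivation "map_poly D" by (rule map_poly_derivation)
  show ?thesis
  proof
    fix f g :: "'K ratfun"
    obtain a b where f: "b \<noteq> 0" "f = of_poly a / of_poly b" by (rule ratfun_cases)
    obtain c e where g: "e \<noteq> 0" "g = of_poly c / of_poly e" by (rule ratfun_cases)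
    have be: "b * e \<noteq> 0" using f g by simp
    have nz: "of_poly b \<noteq> 0" "of_poly e \<noteq> 0" using f g by auto
    have 1: "f + g = of_poly (a * e + c * b) / of_poly (b * e)"
      using nz by (simp add: f g of_poly_distribs field_simps)
    show "deriv_rf D (f + g) = deriv_rf D f + deriv_rf D g"
      unfolding 1 deriv_rf_quotient[OF D be] unfolding f(2) g(2) deriv_rf_quotient[OF D f(1)]
        deriv_rf_quotient[OF D g(1)]
      unfolding m.mult m.add of_poly_distribs
      using nz by (simp add: divide_simps) (simp add: algebra_simps power2_eq_square)
    have 2: "f * g = of_poly (a * c) / of_poly (b * e)"
      using nz by (simp add: f g of_poly_distribs field_simps)
    show "deriv_rf D (f * g) = deriv_rf D f * g + f * deriv_rf D g"
      unfolding 2 deriv_rf_quotient[OF D be] unfolding f(2) g(2) deriv_rf_quotient[OF D f(1)]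
        deriv_rf_quotient[OF D g(1)]
      unfolding m.mult m.add of_poly_distribs
      using nz by (simp add: divide_simps) (simp add: algebra_simps power2_eq_square)
  qed
qed

lemma deriv_rf_s_var:
  assumes "derivation_over \<iota> D"
  shows "deriv_rf D s_var = 0"
proof -
  interpret derivation D using assms by (rule derivation_over_imp_derivation)
  show ?thesis using deriv_rf_of_poly[OF assms, of "[:0, 1:]"] by (simp add: s_var_def map_poly_pCons)
qed

text \<open>
  The \<open>p\<close>-th iterate is a derivation which vanishes on polynomials, hence on their quotients.
\<close>
lemma deriv_rf_funpow_CHAR:
  fixes D :: "'K::field \<Rightarrow> 'K"
  assumes D: "derivation_over \<iota> D" and p: "prime p" "CHAR('K) = p"
    and Dp: "\<And>z. (D ^^ p) z = 0"
  shows "(deriv_rf D ^^ p) f = 0"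
proof -
  interpret derivation D using D by (rule derivation_over_imp_derivation)
  interpret rf: derivation "deriv_rf D" using D by (rule derivation_deriv_rf)
  interpret E: derivation "deriv_rf D ^^ p" using p by (intro rf.funpow_CHAR) (simp_all add: CHAR_ratfun)
  have *: "(deriv_rf D ^^ n) (of_poly q) = of_poly (map_poly (D ^^ n) q)" for n q
  proof (induction n)
    case (Suc n)
    have "map_poly D (map_poly (D ^^ n) q) = map_poly (D ^^ Suc n) q"
      by (rule poly_eqI) (simp add: coeff_map_poly)
    then show ?case using Suc by (simp add: deriv_rf_of_poly[OF D] o_def)
  qed (simp flip: id_def)
  have 0: "(deriv_rf D ^^ p) (of_poly q) = 0" for q
  proof -
    have "map_poly (D ^^ p) q = 0" by (rule poly_eqI) (simp add: coeff_map_poly Dp)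
    then show ?thesis by (simp add: *)
  qed
  obtain a b where f: "b \<noteq> 0" "f = of_poly a / of_poly b" by (rule ratfun_cases)
  have "(deriv_rf D ^^ p) (f * of_poly b) = (deriv_rf D ^^ p) f * of_poly b"
    by (simp add: E.mult 0)
  moreover have "f * of_poly b = of_poly a" using f by simp
  ultimately show ?thesis using 0[of a] f(1) by simp
qed

section \<open>Characteristic polynomials\<close>

lemma index_mult_mat_sum:
  assumes "A \<in> carrier_mat n m" "B \<in> carrier_mat m l" "i < n" "j < l"
  shows "(A * B) $$ (i, j) = (\<Sum>k<m. A $$ (i, k) * B $$ (k, j))"
  using assms by (simp add: scalar_prod_def atLeast0LessThan)

lemma mult_mat_unit_vec:
  fixes A :: "'a::semiring_1 mat"
  assumes "A \<in> carrier_mat n m" "j < m"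
  shows "A *\<^sub>v unit_vec m j = col A j"
  using assms by (intro eq_vecI) (auto simp: scalar_prod_right_unit)

lemma index_mult_mat_vec_sum:
  assumes "A \<in> carrier_mat n m" "v \<in> carrier_vec m" "i < n"
  shows "(A *\<^sub>v v) $ i = (\<Sum>k<m. A $$ (i, k) * v $ k)"
  using assms by (simp add: scalar_prod_def atLeast0LessThan)

lemma elements_mat_subsetD:
  assumes "elements_mat A \<subseteq> R" "A \<in> carrier_mat n m" "i < n" "j < m"
  shows "A $$ (i, j) \<in> R"
  using elements_matI[OF assms(2-4) refl] assms(1) by (rule subsetD[rotated])

lemma elements_mat_subsetI:
  assumes "A \<in> carrier_mat n m" "\<And>i j. i < n \<Longrightarrow> j < m \<Longrightarrow> A $$ (i, j) \<in> R"
  shows "elements_mat A \<subseteq> R"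
proof
  fix x assume "x \<in> elements_mat A"
  then obtain i j where "i < dim_row A" "j < dim_col A" "x = A $$ (i, j)"
    by (auto dest: elements_matD)
  then show "x \<in> R" using assms by simp
qed

text \<open>
  A ring homomorphism that is defined only on a subring \<open>R\<close> of its type. The examples are the
  evaluations at \<open>s = 0\<close> and \<open>s = \<infinity>\<close>, which make sense on the local rings of these points; they have
  to be carried through determinants and characteristic polynomials.
\<close>
locale subring_hom =
  fixes R :: "'a::comm_ring_1 set" and h :: "'a \<Rightarrow> 'b::comm_ring_1"
  assumes one: "1 \<in> R" "h 1 = 1"
    and diff: "\<And>a b. a \<in> R \<Longrightarrow> b \<in> R \<Longrightarrow> a - b \<in> R"
      "\<And>a b. a \<in> R \<Longrightarrow> b \<in> R \<Longrightarrow> h (a - b) = h a - h b"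
    and mult: "\<And>a b. a \<in> R \<Longrightarrow> b \<in> R \<Longrightarrow> a * b \<in> R"
      "\<And>a b. a \<in> R \<Longrightarrow> b \<in> R \<Longrightarrow> h (a * b) = h a * h b"
begin

lemma zero: "0 \<in> R" "h 0 = 0"
  using diff[OF one(1) one(1)] by simp_all

lemma uminus: "a \<in> R \<Longrightarrow> - a \<in> R" "a \<in> R \<Longrightarrow> h (- a) = - h a"
  using diff[of 0 a] zero by simp_all

lemma add: "a \<in> R \<Longrightarrow> b \<in> R \<Longrightarrow> a + b \<in> R" "a \<in> R \<Longrightarrow> b \<in> R \<Longrightarrow> h (a + b) = h a + h b"
  using diff[of a "- b"] uminus[of b] by simp_all

lemma sum:
  assumes "\<And>i. i \<in> A \<Longrightarrow> f i \<in> R"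
  shows "sum f A \<in> R" "h (sum f A) = (\<Sum>i\<in>A. h (f i))"
proof -
  have "sum f A \<in> R \<and> h (sum f A) = (\<Sum>i\<in>A. h (f i))"
    using assms by (induction A rule: infinite_finite_induct) (auto simp: zero add)
  then show "sum f A \<in> R" "h (sum f A) = (\<Sum>i\<in>A. h (f i))" by auto
qed

lemma prod:
  assumes "\<And>i. i \<in> A \<Longrightarrow> f i \<in> R"
  shows "prod f A \<in> R" "h (prod f A) = (\<Prod>i\<in>A. h (f i))"
proof -
  have "prod f A \<in> R \<and> h (prod f A) = (\<Prod>i\<in>A. h (f i))"
    using assms by (induction A rule: infinite_finite_induct) (auto simp: one mult)
  then show "prod f A \<in> R" "h (prod f A) = (\<Prod>i\<in>A. h (f i))" by auto
qed

lemma map_poly: "subring_hom {q. \<forall>i. coeff q i \<in> R} (map_poly h)"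
proof
  show "1 \<in> {q. \<forall>i. coeff q i \<in> R}" by (simp add: coeff_1 one zero)
  show "map_poly h 1 = 1" by (simp add: one)
next
  fix f g :: "'a poly" assume "f \<in> {q. \<forall>i. coeff q i \<in> R}" "g \<in> {q. \<forall>i. coeff q i \<in> R}"
  then have f: "coeff f i \<in> R" and g: "coeff g i \<in> R" for i by auto
  show "f - g \<in> {q. \<forall>i. coeff q i \<in> R}" using f g by (simp add: diff)
  show "map_poly h (f - g) = map_poly h f - map_poly h g"
    using f g by (intro poly_eqI) (simp add: coeff_map_poly zero diff)
  show "f * g \<in> {q. \<forall>i. coeff q i \<in> R}"
    using f g by (auto simp: coeff_mult intro!: sum mult)
  show "map_poly h (f * g) = map_poly h f * map_poly h g"
  proof (rule poly_eqI)
    fix n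
    have "h (\<Sum>i\<le>n. coeff f i * coeff g (n - i)) = (\<Sum>i\<le>n. h (coeff f i * coeff g (n - i)))"
      using f g by (intro sum(2) mult(1))
    then show "coeff (map_poly h (f * g)) n = coeff (map_poly h f * map_poly h g) n"
      using f g by (simp add: coeff_map_poly zero coeff_mult mult(2))
  qed
qed

lemma mult_mat:
  assumes "A \<in> carrier_mat n m" "B \<in> carrier_mat m l" "elements_mat A \<subseteq> R" "elements_mat B \<subseteq> R"
  shows "elements_mat (A * B) \<subseteq> R" "map_mat h (A * B) = map_mat h A * map_mat h B"
proof -
  have e: "A $$ (i, k) * B $$ (k, j) \<in> R" if "i < n" "k < m" "j < l" for i j k
    using elements_mat_subsetD[OF assms(3,1)] elements_mat_subsetD[OF assms(4,2)] that
    by (intro mult(1))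
  show "elements_mat (A * B) \<subseteq> R"
    using assms(1,2) e
    by (intro elements_mat_subsetI[of _ n l])
      (auto simp del: index_mult_mat(1) simp: index_mult_mat_sum[OF assms(1,2)] intro!: sum(1))
  show "map_mat h (A * B) = map_mat h A * map_mat h B"
  proof (rule eq_matI)
    fix i j assume "i < dim_row (map_mat h A * map_mat h B)" "j < dim_col (map_mat h A * map_mat h B)"
    then have ij: "i < n" "j < l" using assms by auto
    have "map_mat h (A * B) $$ (i, j) = h (\<Sum>k<m. A $$ (i, k) * B $$ (k, j))"
      using assms ij by (subst index_mult_mat_sum[OF assms(1,2) ij, symmetric]) simp
    also have "\<dots> = (\<Sum>k<m. h (A $$ (i, k) * B $$ (k, j)))"
      using e ij by (intro sum(2)) simp
    also have "\<dots> = (\<Sum>k<m. h (A $$ (i, k)) * h (B $$ (k, j)))"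
      using elements_mat_subsetD[OF assms(3,1)] elements_mat_subsetD[OF assms(4,2)] ij
      by (intro sum.cong refl mult(2)) auto
    also have "\<dots> = (map_mat h A * map_mat h B) $$ (i, j)"
      using assms ij by (subst index_mult_mat_sum[where n = n and m = m and l = l]) auto
    finally show "map_mat h (A * B) $$ (i, j) = (map_mat h A * map_mat h B) $$ (i, j)" .
  qed (use assms in auto)
qed

lemma det:
  assumes A: "A \<in> carrier_mat n n" "elements_mat A \<subseteq> R"
  shows "det A \<in> R" "h (det A) = det (map_mat h A)"
proof -
  have s: "signof \<pi> \<in> R \<and> h (signof \<pi>) = signof \<pi>" for \<pi> :: "nat \<Rightarrow> nat"
    by (cases \<pi> rule: sign_cases) (simp_all add: one uminus)
  have e: "A $$ (i, \<pi> i) \<in> R" if "\<pi> permutes {0..<n}" "i < n" for \<pi> i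
  proof -
    have "\<pi> i < n" using that permutes_in_image[OF that(1), of i] by simp
    then show ?thesis using elements_mat_subsetD[OF A(2,1)] that(2) by blast
  qed
  show "det A \<in> R"
    unfolding det_def'[OF A(1)] by (auto intro!: sum mult prod e simp: s)
  have *: "h (signof \<pi> * (\<Prod>i = 0..<n. A $$ (i, \<pi> i))) = signof \<pi> * (\<Prod>i = 0..<n. h (A $$ (i, \<pi> i)))"
    if "\<pi> permutes {0..<n}" for \<pi>
  proof -
    have "(\<Prod>i = 0..<n. A $$ (i, \<pi> i)) \<in> R"
      "h (\<Prod>i = 0..<n. A $$ (i, \<pi> i)) = (\<Prod>i = 0..<n. h (A $$ (i, \<pi> i)))"
      using e[OF that] by (auto intro: prod)
    then show ?thesis using s[of \<pi>] mult(2) by metis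
  qed
  have "h (det A) = (\<Sum>\<pi> | \<pi> permutes {0..<n}. signof \<pi> * (\<Prod>i = 0..<n. h (A $$ (i, \<pi> i))))"
    unfolding det_def'[OF A(1)]
    by (subst sum(2)) (auto intro!: mult prod e sum.cong simp: s *)
  also have "\<dots> = det (map_mat h A)"
    using A(1) by (subst det_def'[of _ n])
      (auto intro!: sum.cong prod.cong arg_cong2[where f = "(*)"] simp: permutes_in_image)
  finally show "h (det A) = det (map_mat h A)" .
qed

lemma char_poly:
  assumes A: "A \<in> carrier_mat n n" "elements_mat A \<subseteq> R"
  shows "coeff (char_poly A) i \<in> R" "h (coeff (char_poly A) i) = coeff (char_poly (map_mat h A)) i"
proof -
  interpret P: subring_hom "{q. \<forall>i. coeff q i \<in> R}" "map_poly h" by (rule map_poly)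
  have C: "char_poly_matrix A \<in> carrier_mat n n" using A(1) by simp
  have e: "elements_mat (char_poly_matrix A) \<subseteq> {q. \<forall>i. coeff q i \<in> R}"
  proof (rule elements_mat_subsetI[OF C])
    fix i j assume ij: "i < n" "j < n"
    show "char_poly_matrix A $$ (i, j) \<in> {q. \<forall>i. coeff q i \<in> R}"
      using A(1) ij elements_mat_subsetD[OF A(2,1) ij]
      by (auto simp: char_poly_matrix_def coeff_pCons one zero uminus add split: nat.splits)
  qed
  have "map_mat (map_poly h) (char_poly_matrix A) = char_poly_matrix (map_mat h A)"
  proof (rule eq_matI)
    fix i j assume "i < dim_row (char_poly_matrix (map_mat h A))"
      "j < dim_col (char_poly_matrix (map_mat h A))"
    then have ij: "i < n" "j < n" using A(1) by (auto simp: char_poly_matrix_def)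
    then have "A $$ (i, j) \<in> R" by (rule elements_mat_subsetD[OF A(2,1)])
    then show "map_mat (map_poly h) (char_poly_matrix A) $$ (i, j) =
        char_poly_matrix (map_mat h A) $$ (i, j)"
      using ij A(1)
      by (auto intro!: poly_eqI simp: char_poly_matrix_def coeff_map_poly coeff_pCons one zero uminus add
          split: nat.splits)
  qed (use A(1) in \<open>auto simp: char_poly_matrix_def\<close>)
  then have 1: "map_poly h (char_poly A) = char_poly (map_mat h A)"
    using P.det(2)[OF C e] by (simp add: char_poly_def)
  show "coeff (char_poly A) i \<in> R" using P.det(1)[OF C e] by (simp add: char_poly_def)
  show "h (coeff (char_poly A) i) = coeff (char_poly (map_mat h A)) i"
    using zero by (simp flip: 1 add: coeff_map_poly)
qed

end

lemma pcompose_comm_ring_hom: "comm_ring_hom (\<lambda>q. q \<circ>\<^sub>p r :: 'a::comm_ring_1 poly)"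
  by standard (simp_all add: pcompose_add pcompose_mult pcompose_1)

text \<open>
  Scaling the matrix scales its eigenvalues: substituting \<open>c x\<close> for \<open>x\<close> turns \<open>x - c A\<close> into
  \<open>c (x - A)\<close>.
\<close>
lemma coeff_char_poly_smult:
  fixes A :: "'a::idom mat"
  assumes A: "A \<in> carrier_mat n n" and c: "c \<noteq> 0" and i: "i \<le> n"
  shows "coeff (char_poly (c \<cdot>\<^sub>m A)) i = c ^ (n - i) * coeff (char_poly A) i"
proof -
  let ?f = "\<lambda>q. q \<circ>\<^sub>p [:0, c:]"
  have "map_mat ?f (char_poly_matrix (c \<cdot>\<^sub>m A)) = [:c:] \<cdot>\<^sub>m char_poly_matrix A"
    using A by (intro eq_matI) (auto simp: char_poly_matrix_def pcompose_pCons)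
  then have "?f (char_poly (c \<cdot>\<^sub>m A)) = det ([:c:] \<cdot>\<^sub>m char_poly_matrix A)"
    unfolding char_poly_def by (simp flip: comm_ring_hom.hom_det[OF pcompose_comm_ring_hom])
  also have "\<dots> = [:c:] ^ n * char_poly A"
    using carrier_matD(2)[OF char_poly_matrix_closed[OF A]] by (simp add: char_poly_def)
  also have "[:c:] ^ n = [:c ^ n:]" by (simp add: poly_const_pow)
  finally have "?f (char_poly (c \<cdot>\<^sub>m A)) = [:c ^ n:] * char_poly A" .
  then have "coeff (?f (char_poly (c \<cdot>\<^sub>m A))) i = c ^ n * coeff (char_poly A) i" by simp
  then have "c ^ i * coeff (char_poly (c \<cdot>\<^sub>m A)) i = c ^ i * (c ^ (n - i) * coeff (char_poly A) i)"
    using i by (simp add: coeff_pcompose_linear flip: power_add mult.assoc)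
  then show ?thesis using c by simp
qed

lemma char_poly_eqI:
  assumes "A \<in> carrier_mat n n" "B \<in> carrier_mat n n"
    and "\<And>i. i \<le> n \<Longrightarrow> coeff (char_poly A) i = coeff (char_poly B) i"
  shows "char_poly A = char_poly B"
proof (rule poly_eqI)
  fix i
  show "coeff (char_poly A) i = coeff (char_poly B) i"
    using assms degree_monic_char_poly[of A n] degree_monic_char_poly[of B n]
    by (cases "i \<le> n") (auto simp: coeff_eq_0)
qed

lemma det_pow_mat:
  assumes "A \<in> carrier_mat n n"
  shows "det (A ^\<^sub>m k) = (det A :: 'a::comm_ring_1) ^ k"
  using assms by (induction k) (auto simp: det_mult[of _ n])

lemma pow_mat_Suc_left:
  fixes A :: "'a::semiring_1 mat"
  assumes "A \<in> carrier_mat n n"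
  shows "A ^\<^sub>m Suc k = A * A ^\<^sub>m k"
proof (induction k)
  case 0
  then show ?case using assms by simp
next
  case (Suc k)
  then show ?case using assms by (simp add: assoc_mult_mat[of _ n n _ n _ n])
qed

text \<open>
  The eigenvalues of the \<open>p\<close>-th power of \<open>A\<close> are the \<open>p\<close>-th powers of those of \<open>A\<close>. In
  characteristic \<open>p\<close> this follows without a splitting field: the scalar matrix \<open>x\<close> commutes with \<open>A\<close>,
  so the \<open>p\<close>-th power of \<open>x - A\<close> is the difference of the \<open>p\<close>-th powers. Its determinant is the
  characteristic polynomial of the power of \<open>A\<close> at the \<open>p\<close>-th power of \<open>x\<close>.
\<close>
lemma char_poly_pow_CHAR:
  fixes A :: "'a::idom mat"
  assumes A: "A \<in> carrier_mat n n" and p: "prime p" "CHAR('a) = p"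
  shows "char_poly (A ^\<^sub>m p) = map_poly (\<lambda>c. c ^ p) (char_poly A)"
proof -
  let ?X = "[:0, 1:] :: 'a poly"
  define M where "M = map_mat (\<lambda>a. [:a:]) A"
  have M: "M \<in> carrier_mat n n" using A by (simp add: M_def)
  have M1: "char_poly_matrix A = ?X \<cdot>\<^sub>m 1\<^sub>m n - M"
    using A by (intro eq_matI) (auto simp: char_poly_matrix_def M_def)
  define T where "T = ?X \<cdot>\<^sub>m 1\<^sub>m n - M"
  have T: "T \<in> carrier_mat n n" using M by (simp add: T_def minus_carrier_mat)
  have Tw: "T * W = ?X \<cdot>\<^sub>m W - M * W" if "W \<in> carrier_mat n n" for W
    using M that by (simp add: T_def minus_mult_distrib_mat[of _ n n] mult_smult_assoc_mat[of _ n n _ n])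
  have neg: "(- M) ^\<^sub>m Suc m = - (M * (- M) ^\<^sub>m m)" for m
    using M by (subst pow_mat_Suc_left[of _ n]) auto
  have "T ^\<^sub>m p = (?X ^ p) \<cdot>\<^sub>m 1\<^sub>m n + (- M) ^\<^sub>m p"
  proof (rule eq_matI)
    fix i k assume "i < dim_row ((?X ^ p) \<cdot>\<^sub>m 1\<^sub>m n + (- M) ^\<^sub>m p)"
      "k < dim_col ((?X ^ p) \<cdot>\<^sub>m 1\<^sub>m n + (- M) ^\<^sub>m p)"
    then have ik: "i < n" "k < n" using M by (auto split: if_splits)
    \<comment> \<open>Left multiplication by \<open>x - M\<close> raises the exponent of either \<open>x\<close> or \<open>- M\<close>.\<close>
    let ?W = "\<lambda>j m. (?X ^ j) \<cdot>\<^sub>m (- M) ^\<^sub>m m"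
    let ?b = "\<lambda>l j m. (T ^\<^sub>m l * ?W j m) $$ (i, k)"
    have W: "?W j m \<in> carrier_mat n n" for j m using M by simp
    have "?b (Suc l) j m = ?b l (Suc j) m + ?b l j (Suc m)" for l j m
    proof -
      have "T * ?W j m = ?W (Suc j) m + ?W j (Suc m)"
      proof -
        have "T * ?W j m = ?W (Suc j) m - (?X ^ j) \<cdot>\<^sub>m (M * (- M) ^\<^sub>m m)"
          unfolding Tw[OF W]
          using M by (subst mult_smult_distrib[of _ n n _ n]) (auto intro!: eq_matI simp: mult.assoc)
        also have "\<dots> = ?W (Suc j) m + ?W j (Suc m)"
          unfolding neg using M by (intro eq_matI) auto
        finally show ?thesis .
      qed
      moreover have "T ^\<^sub>m Suc l * ?W j m = T ^\<^sub>m l * (T * ?W j m)"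
        unfolding pow_mat.simps by (rule assoc_mult_mat[OF pow_carrier_mat[OF T] T W])
      ultimately have "T ^\<^sub>m Suc l * ?W j m = T ^\<^sub>m l * ?W (Suc j) m + T ^\<^sub>m l * ?W j (Suc m)"
        using mult_add_distrib_mat[OF pow_carrier_mat[OF T] W W] by (simp only:)
      then show ?thesis using T W ik M by (simp only: index_add_mat) simp
    qed
    from binomial_recursion_CHAR[of ?b, OF this p(1)]
    have "?b p 0 0 = ?b 0 p 0 + ?b 0 0 p" using p(2) by simp
    then show "(T ^\<^sub>m p) $$ (i, k) = ((?X ^ p) \<cdot>\<^sub>m 1\<^sub>m n + (- M) ^\<^sub>m p) $$ (i, k)"
      using T M ik by simp
  qed (use T M in auto)
  also have "(- M) ^\<^sub>m p = - (M ^\<^sub>m p)"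
  proof -
    have "(- M) ^\<^sub>m m = ((- 1) ^ m) \<cdot>\<^sub>m M ^\<^sub>m m" for m
    proof (induction m)
      case (Suc m)
      then show ?case using M
        by (simp add: mult_smult_assoc_mat[of _ n n _ n]) (intro eq_matI, auto)
    qed (use M in auto)
    moreover have "(- 1 :: 'a poly) ^ p = - 1"
      using minus_power_prime_CHAR[of p "1 :: 'a poly"] p by simp
    ultimately show ?thesis by (simp add: uminus_mat_def smult_mat_def map_mat_def)
  qed
  also have "(?X ^ p) \<cdot>\<^sub>m 1\<^sub>m n + - (M ^\<^sub>m p) =
      map_mat (\<lambda>q. q \<circ>\<^sub>p monom 1 p) (char_poly_matrix (A ^\<^sub>m p))"
  proof -
    interpret c: comm_ring_hom "\<lambda>a. [:a:] :: 'a poly"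
      by standard (auto simp: one_pCons)
    have "M ^\<^sub>m p = map_mat (\<lambda>a. [:a:]) (A ^\<^sub>m p)"
      unfolding M_def by (rule c.mat_hom_pow[OF A, symmetric])
    moreover have "?X ^ p = monom 1 p" by (simp add: monom_altdef)
    moreover have "A ^\<^sub>m p \<in> carrier_mat n n" using A by simp
    ultimately show ?thesis
      by (intro eq_matI) (auto simp: char_poly_matrix_def pcompose_pCons pcompose_add pcompose_uminus
        simp del: pow_mat_dim)
  qed
  finally have "det (char_poly_matrix A) ^ p = char_poly (A ^\<^sub>m p) \<circ>\<^sub>p monom 1 p"
    using T by (simp add: char_poly_def M1 T_def[symmetric] flip: det_pow_mat comm_ring_hom.hom_det[OF pcompose_comm_ring_hom])
  then have "map_poly (\<lambda>c. c ^ p) (char_poly A) \<circ>\<^sub>p monom 1 p = char_poly (A ^\<^sub>m p) \<circ>\<^sub>p monom 1 p"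
    by (simp add: char_poly_def power_CHAR_poly[OF p])
  then have "(char_poly (A ^\<^sub>m p) - map_poly (\<lambda>c. c ^ p) (char_poly A)) \<circ>\<^sub>p monom 1 p = 0"
    by (simp add: pcompose_diff)
  moreover have "degree (monom 1 p :: 'a poly) > 0"
    using prime_gt_0_nat[OF p(1)] by (simp add: degree_monom_eq)
  ultimately have "char_poly (A ^\<^sub>m p) - map_poly (\<lambda>c. c ^ p) (char_poly A) = 0"
    by (rule pcompose_eq_0)
  then show ?thesis by simp
qed

lemma char_poly_frobenius_twist:
  fixes A :: "'a::field mat"
  assumes A: "A \<in> carrier_mat n n" and p: "prime p" "CHAR('a) = p"
  shows "char_poly (frobenius_twist p A) = map_poly (\<lambda>c. c ^ p) (char_poly A)"
proof -
  interpret f: comm_ring_hom "\<lambda>a::'a. a ^ p"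
    using p prime_gt_0_nat[OF p(1)]
    by unfold_locales (auto simp: freshmans_dream power_mult_distrib power_0_left)
  show ?thesis unfolding frobenius_twist_def by (rule f.char_poly_hom[OF A])
qed

section \<open>Powers of a connection\<close>

text \<open>
  The columns are the images of the standard basis under the \<open>n\<close>-th iterate of \<open>d - M\<close>. The iterate
  is given by multiplication with this matrix only if it is linear, as for \<open>n = p\<close> if the \<open>p\<close>-th
  iterate of \<open>d\<close> vanishes.
\<close>
primrec covariant_power :: "('a::comm_ring_1 \<Rightarrow> 'a) \<Rightarrow> 'a mat \<Rightarrow> nat \<Rightarrow> 'a mat" where
  "covariant_power d M 0 = 1\<^sub>m (dim_row M)"
| "covariant_power d M (Suc n) =
    map_mat d (covariant_power d M n) - M * covariant_power d M n"

lemma covariant_power_carrier [simp]: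
  "M \<in> carrier_mat N N \<Longrightarrow> covariant_power d M n \<in> carrier_mat N N"
  by (induction n) auto

lemma (in comm_ring_hom) covariant_power_hom:
  assumes M: "M \<in> carrier_mat N N" and d: "\<And>a. hom (d a) = d' (hom a)"
  shows "covariant_power d' (map_mat hom M) n = map_mat hom (covariant_power d M n)"
proof (induction n)
  case 0
  then show ?case using M by (auto simp: mat_hom_one)
next
  case (Suc n)
  let ?C = "covariant_power d M n"
  have C: "?C \<in> carrier_mat N N" using M by simp
  have "map_mat hom (map_mat d ?C - M * ?C) = map_mat d' (map_mat hom ?C) - map_mat hom M * map_mat hom ?C"
    unfolding mat_hom_mult[OF M C, symmetric]
    using M carrier_matD[OF C] by (intro eq_matI) (auto simp: hom_minus d)
  then show ?case by (simp add: Suc)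
qed

definition conn :: "('a::comm_ring_1 \<Rightarrow> 'a) \<Rightarrow> 'a mat \<Rightarrow> 'a vec \<Rightarrow> 'a vec" where
  "conn d M v = map_vec d v - M *\<^sub>v v"

lemma nabla_conv_conn: "nabla D M = conn (deriv_rf D) M"
  by (simp add: fun_eq_iff nabla_def conn_def)

context derivation
begin

lemma conn_carrier [simp]:
  "M \<in> carrier_mat N N \<Longrightarrow> v \<in> carrier_vec N \<Longrightarrow> conn d M v \<in> carrier_vec N"
  by (simp add: conn_def)

lemma conn_funpow_carrier [simp]:
  "M \<in> carrier_mat N N \<Longrightarrow> v \<in> carrier_vec N \<Longrightarrow> (conn d M ^^ n) v \<in> carrier_vec N"
  by (induction n) auto

lemma conn_add:
  assumes "M \<in> carrier_mat N N" "v \<in> carrier_vec N" "w \<in> carrier_vec N"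
  shows "conn d M (v + w) = conn d M v + conn d M w"
proof -
  have "map_vec d (v + w) = map_vec d v + map_vec d w"
    using assms by (intro eq_vecI) (auto simp: add)
  moreover have "M *\<^sub>v (v + w) = M *\<^sub>v v + M *\<^sub>v w"
    using assms by (rule mult_add_distrib_mat_vec)
  ultimately show ?thesis using assms unfolding conn_def by (intro eq_vecI) auto
qed

lemma conn_funpow_add:
  assumes "M \<in> carrier_mat N N" "v \<in> carrier_vec N" "w \<in> carrier_vec N"
  shows "(conn d M ^^ n) (v + w) = (conn d M ^^ n) v + (conn d M ^^ n) w"
  using assms by (induction n) (auto simp: conn_add)

lemma conn_covariant_power_mult:
  assumes M: "M \<in> carrier_mat N N" and w: "w \<in> carrier_vec N"
  shows "conn d M (covariant_power d M n *\<^sub>v w) =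
    covariant_power d M n *\<^sub>v map_vec d w + covariant_power d M (Suc n) *\<^sub>v w"
proof -
  let ?C = "covariant_power d M n"
  have C: "?C \<in> carrier_mat N N" using M by simp
  have "map_vec d (?C *\<^sub>v w) = map_mat d ?C *\<^sub>v w + ?C *\<^sub>v map_vec d w"
  proof (rule eq_vecI)
    fix i assume "i < dim_vec (map_mat d ?C *\<^sub>v w + ?C *\<^sub>v map_vec d w)"
    then have i: "i < N" using C by simp
    have "map_vec d (?C *\<^sub>v w) $ i = d (\<Sum>k<N. ?C $$ (i, k) * w $ k)"
      using C w i by (subst index_mult_mat_vec_sum[OF C w i, symmetric]) auto
    also have "\<dots> = (\<Sum>k<N. d (?C $$ (i, k)) * w $ k) + (\<Sum>k<N. ?C $$ (i, k) * d (w $ k))"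
      by (simp add: sum mult sum.distrib)
    also have "\<dots> = (map_mat d ?C *\<^sub>v w + ?C *\<^sub>v map_vec d w) $ i"
      using C w i index_mult_mat_vec_sum[of "map_mat d ?C" N N w i]
        index_mult_mat_vec_sum[of ?C N N "map_vec d w" i]
      by (simp del: index_mult_mat_vec)
    finally show "map_vec d (?C *\<^sub>v w) $ i = (map_mat d ?C *\<^sub>v w + ?C *\<^sub>v map_vec d w) $ i" .
  qed (use C in auto)
  moreover have "covariant_power d M (Suc n) *\<^sub>v w = map_mat d ?C *\<^sub>v w - M *\<^sub>v (?C *\<^sub>v w)"
    using M C w by (simp add: minus_mult_distrib_mat_vec[of _ N N] assoc_mult_mat_vec[of M N N ?C N w])
  ultimately show ?thesis using M C w carrier_matD[OF C]
    unfolding conn_def by (intro eq_vecI) (auto simp del: covariant_power.simps)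
qed

text \<open>
  By the product rule of the preceding lemma, \<open>d - M\<close> either differentiates the vector or raises the
  order of the matrix. After \<open>p\<close> steps only the pure terms remain, and the one with the derivative of
  the vector vanishes by hypothesis.
\<close>
lemma conn_funpow_CHAR:
  assumes M: "M \<in> carrier_mat N N" and v: "v \<in> carrier_vec N"
    and p: "prime p" "CHAR('a) = p" and dp: "\<And>a. (d ^^ p) a = 0"
  shows "(conn d M ^^ p) v = covariant_power d M p *\<^sub>v v"
proof (rule eq_vecI)
  fix i assume "i < dim_vec (covariant_power d M p *\<^sub>v v)"
  then have i: "i < N" using M by (simp add: carrier_matD[OF covariant_power_carrier[OF M]])
  let ?w = "\<lambda>j. (map_vec d ^^ j) v"
  let ?a = "\<lambda>j m. covariant_power d M m *\<^sub>v ?w j"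
  let ?b = "\<lambda>n j m. ((conn d M ^^ n) (?a j m)) $ i"
  have w: "?w j \<in> carrier_vec N" for j using v by (induction j) auto
  have a: "?a j m \<in> carrier_vec N" for j m using M w by (intro mult_mat_vec_carrier) auto
  have "?b (Suc n) j m = ?b n (Suc j) m + ?b n j (Suc m)" for n j m
  proof -
    have "(conn d M ^^ Suc n) (?a j m) = (conn d M ^^ n) (?a (Suc j) m + ?a j (Suc m))"
      using conn_covariant_power_mult[OF M w, of m j] by (simp add: funpow_swap1 del: covariant_power.simps)
    also have "\<dots> = (conn d M ^^ n) (?a (Suc j) m) + (conn d M ^^ n) (?a j (Suc m))"
      by (rule conn_funpow_add[OF M a a])
    finally show ?thesis
      using carrier_vecD[OF conn_funpow_carrier[OF M a]] i by (simp del: covariant_power.simps funpow.simps)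
  qed
  from binomial_recursion_CHAR[of ?b, OF this p]
  have "?b p 0 0 = ?b 0 p 0 + ?b 0 0 p" .
  moreover have "?w j $ i = (d ^^ j) (v $ i) \<and> dim_vec (?w j) = N" for j
    using v i by (induction j) auto
  then have "?w p $ i = 0" using dp by simp
  ultimately show "(conn d M ^^ p) v $ i = (covariant_power d M p *\<^sub>v v) $ i"
    using M v w[of p] i by (simp del: index_mult_mat_vec)
qed (use M v carrier_vecD[OF conn_funpow_carrier[OF M v]] carrier_matD[OF covariant_power_carrier[OF M]] in simp)

text \<open>
  Gauge equivalence intertwines the \<open>p\<close>-th iterates. As these are linear, it conjugates their
  matrices, although in general it does not conjugate \<open>M\<close> and \<open>M'\<close>.
\<close>
lemma char_poly_covariant_power_CHAR_gauge:
  assumes M: "M \<in> carrier_mat N N" and M': "M' \<in> carrier_mat N N"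
    and G: "mutually_inverse N G H"
    and GM: "\<And>v. v \<in> carrier_vec N \<Longrightarrow> conn d M' (G *\<^sub>v v) = G *\<^sub>v conn d M v"
    and p: "prime p" "CHAR('a) = p" and dp: "\<And>a. (d ^^ p) a = 0"
  shows "char_poly (covariant_power d M' p) = char_poly (covariant_power d M p)"
proof -
  let ?C = "covariant_power d M p" and ?C' = "covariant_power d M' p"
  have c: "G \<in> carrier_mat N N" "H \<in> carrier_mat N N" "?C \<in> carrier_mat N N" "?C' \<in> carrier_mat N N"
    and GH: "G * H = 1\<^sub>m N" "H * G = 1\<^sub>m N"
    using G M M' by (auto simp: mutually_inverse_def)
  have pow: "(conn d M' ^^ n) (G *\<^sub>v v) = G *\<^sub>v (conn d M ^^ n) v" if "v \<in> carrier_vec N" for n v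
    using that M by (induction n) (auto simp: GM)
  have "?C' * G = G * ?C"
  proof (rule mat_col_eqI)
    fix j assume "j < dim_col (G * ?C)"
    then have j: "j < N" using c by simp
    let ?e = "unit_vec N j :: 'a vec"
    have e: "?e \<in> carrier_vec N" by simp
    have "?C' *\<^sub>v (G *\<^sub>v ?e) = G *\<^sub>v (?C *\<^sub>v ?e)"
      using pow[OF e, of p] conn_funpow_CHAR[OF M e p dp] conn_funpow_CHAR[OF M' _ p dp, of "G *\<^sub>v ?e"] c
      by simp
    then show "col (?C' * G) j = col (G * ?C) j"
      by (simp only: col_mult2[OF c(4,1) j] col_mult2[OF c(1,3) j]
          mult_mat_unit_vec[OF c(1) j] mult_mat_unit_vec[OF c(3) j])
  qed (use c in auto)
  then have "?C' * G * H = G * ?C * H" by simp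
  then have "?C' = G * ?C * H"
    using c GH by (simp add: assoc_mult_mat[of _ N N _ N _ N])
  then have "similar_mat ?C' ?C"
    using c GH by (intro similar_matI[of _ _ G H N]) auto
  then show ?thesis by (rule char_poly_similar)
qed

end

section \<open>Regularity at \<open>s = 0\<close> and \<open>s = \<infinity>\<close>\<close>

lemma regular_at_0_conv:
  "regular_at_0 f \<longleftrightarrow> (\<exists>a b. poly b 0 \<noteq> 0 \<and> f = of_poly a / of_poly b)"
  unfolding regular_at_0_def by (metis Fract_conv_of_poly poly_0)

lemma regular_at_0I: "poly b 0 \<noteq> 0 \<Longrightarrow> regular_at_0 (of_poly a / of_poly b)"
  by (auto simp: regular_at_0_conv)

lemma value_at_0_quotient:
  "poly b 0 \<noteq> 0 \<Longrightarrow> value_at_0 (of_poly a / of_poly b) = poly a 0 / poly b 0"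
  using value_at_0_Fract[of b a] by (metis Fract_conv_of_poly poly_0)

lemma subring_hom_value_at_0:
  "subring_hom {f::'a::field ratfun. regular_at_0 f} value_at_0"
proof
  have 1: "(1 :: 'a ratfun) = of_poly 1 / of_poly 1" by simp
  show "1 \<in> {f::'a ratfun. regular_at_0 f}" unfolding 1 mem_Collect_eq by (rule regular_at_0I) simp
  show "value_at_0 (1 :: 'a ratfun) = 1"
    unfolding 1 by (subst value_at_0_quotient) auto
next
  fix f g :: "'a ratfun" assume "f \<in> {f. regular_at_0 f}" "g \<in> {f. regular_at_0 f}"
  then obtain a b c e where f: "poly b 0 \<noteq> 0" "f = of_poly a / of_poly b"
    and g: "poly e 0 \<noteq> 0" "g = of_poly c / of_poly e"
    by (auto simp: regular_at_0_conv)
  have nz: "of_poly b \<noteq> 0" "of_poly e \<noteq> 0" using f(1) g(1) by auto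
  have be: "poly (b * e) 0 \<noteq> 0" using f g by simp
  have 1: "f - g = of_poly (a * e - c * b) / of_poly (b * e)"
    and 2: "f * g = of_poly (a * c) / of_poly (b * e)"
    using nz by (simp_all add: f g of_poly_distribs field_simps)
  show "f - g \<in> {f. regular_at_0 f}" "f * g \<in> {f. regular_at_0 f}"
    unfolding 1 2 using be by (auto intro: regular_at_0I simp del: of_poly.hom_mult)
  show "value_at_0 (f - g) = value_at_0 f - value_at_0 g"
    "value_at_0 (f * g) = value_at_0 f * value_at_0 g"
    unfolding 1 2 value_at_0_quotient[OF be] unfolding f(2) g(2)
      value_at_0_quotient[OF f(1)] value_at_0_quotient[OF g(1)]
    using f(1) g(1) by (simp_all add: field_simps)
qed

lemma value_at_0_deriv_rf:
  assumes D: "derivation_over \<iota> D" and f: "regular_at_0 f"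
  shows "regular_at_0 (deriv_rf D f)" "value_at_0 (deriv_rf D f) = D (value_at_0 f)"
proof -
  interpret derivation D using D by (rule derivation_over_imp_derivation)
  obtain a b where b: "poly b 0 \<noteq> 0" and f: "f = of_poly a / of_poly b"
    using f by (auto simp: regular_at_0_conv)
  have "b \<noteq> 0" using b by auto
  then have 1: "deriv_rf D f =
      of_poly (map_poly D a * b - a * map_poly D b) / of_poly (b ^ 2)"
    unfolding f by (simp add: deriv_rf_quotient[OF D] of_poly_distribs power2_eq_square)
  have b2: "poly (b ^ 2) 0 \<noteq> 0" using b by simp
  show "regular_at_0 (deriv_rf D f)" unfolding 1 by (rule regular_at_0I[OF b2])
  have c: "poly (map_poly D q) 0 = D (poly q 0)" for q
    by (simp add: poly_0_coeff_0 coeff_map_poly)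
  have "D (poly a 0 / poly b 0) * poly b 0 + (poly a 0 / poly b 0) * D (poly b 0) = D (poly a 0)"
    using mult[of "poly a 0 / poly b 0" "poly b 0"] b by simp
  then show "value_at_0 (deriv_rf D f) = D (value_at_0 f)"
    unfolding 1 value_at_0_quotient[OF b2] unfolding f value_at_0_quotient[OF b]
    using b by (simp add: c field_simps power2_eq_square)
qed

lemma coeff_mult_at_degree_bounds:
  fixes a b :: "'a::comm_semiring_0 poly"
  assumes "degree a \<le> m" "degree b \<le> n"
  shows "coeff (a * b) (m + n) = coeff a m * coeff b n"
proof -
  have "coeff (a * b) (m + n) = (\<Sum>i\<in>{m}. coeff a i * coeff b (m + n - i))"
    unfolding coeff_mult
  proof (rule sum.mono_neutral_right)
    show "\<forall>i\<in>{..m + n} - {m}. coeff a i * coeff b (m + n - i) = 0"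
    proof
      fix i assume "i \<in> {..m + n} - {m}"
      then have "i > m \<or> m + n - i > n" by auto
      then show "coeff a i * coeff b (m + n - i) = 0"
        using assms by (auto simp: coeff_eq_0)
    qed
  qed auto
  then show ?thesis by simp
qed

lemma regular_at_inf_conv:
  "regular_at_inf f \<longleftrightarrow> (\<exists>a b. b \<noteq> 0 \<and> f = of_poly a / of_poly b \<and> degree a \<le> degree b)"
  unfolding regular_at_inf_def by (metis Fract_conv_of_poly)

lemma regular_at_infI: "b \<noteq> 0 \<Longrightarrow> degree a \<le> degree b \<Longrightarrow> regular_at_inf (of_poly a / of_poly b)"
  by (auto simp: regular_at_inf_conv)

lemma value_at_inf_quotient:
  "b \<noteq> 0 \<Longrightarrow> degree a \<le> degree b \<Longrightarrow>
    value_at_inf (of_poly a / of_poly b) = coeff a (degree b) / lead_coeff b"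
  using value_at_inf_Fract[of b a] by (simp add: Fract_conv_of_poly)

lemma subring_hom_value_at_inf:
  "subring_hom {f::'a::field ratfun. regular_at_inf f} value_at_inf"
proof
  have 1: "(1 :: 'a ratfun) = of_poly 1 / of_poly 1" by simp
  show "1 \<in> {f::'a ratfun. regular_at_inf f}" unfolding 1 mem_Collect_eq by (rule regular_at_infI) simp_all
  show "value_at_inf (1 :: 'a ratfun) = 1"
    unfolding 1 by (subst value_at_inf_quotient) auto
next
  fix f g :: "'a ratfun" assume "f \<in> {f. regular_at_inf f}" "g \<in> {f. regular_at_inf f}"
  then obtain a b c e where f: "b \<noteq> 0" "degree a \<le> degree b" "f = of_poly a / of_poly b"
    and g: "e \<noteq> 0" "degree c \<le> degree e" "g = of_poly c / of_poly e"
    by (auto simp: regular_at_inf_conv)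
  have nz: "of_poly b \<noteq> 0" "of_poly e \<noteq> 0" using f(1) g(1) by auto
  have be: "b * e \<noteq> 0" using f g by simp
  have deg: "degree (b * e) = degree b + degree e" using f(1) g(1) by (rule degree_mult_eq)
  have d1: "degree (a * e - c * b) \<le> degree (b * e)"
    unfolding deg using degree_mult_le[of a e] degree_mult_le[of c b] f(2) g(2)
    by (intro degree_diff_le) auto
  have d2: "degree (a * c) \<le> degree (b * e)"
    unfolding deg using degree_mult_le[of a c] f(2) g(2) by linarith
  have 1: "f - g = of_poly (a * e - c * b) / of_poly (b * e)"
    and 2: "f * g = of_poly (a * c) / of_poly (b * e)"
    using nz by (simp_all add: f g of_poly_distribs field_simps)
  show "f - g \<in> {f. regular_at_inf f}" "f * g \<in> {f. regular_at_inf f}"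
    unfolding 1 2 using be d1 d2 by (auto intro: regular_at_infI simp del: of_poly.hom_mult)
  have "coeff (c * b) (degree b + degree e) = coeff c (degree e) * lead_coeff b"
    using coeff_mult_at_degree_bounds[OF g(2), of b "degree b"] by (simp add: add.commute)
  then show "value_at_inf (f - g) = value_at_inf f - value_at_inf g"
    "value_at_inf (f * g) = value_at_inf f * value_at_inf g"
    unfolding 1 2 value_at_inf_quotient[OF be d1] value_at_inf_quotient[OF be d2]
    unfolding f(3) g(3) value_at_inf_quotient[OF f(1,2)] value_at_inf_quotient[OF g(1,2)] deg
    using f(1,2) g(1,2) coeff_mult_at_degree_bounds[OF f(2) order.refl[of "degree e"]]
      coeff_mult_at_degree_bounds[OF f(2) g(2)]
    by (simp_all add: lead_coeff_mult deg[symmetric]) (simp_all add: deg field_simps)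
qed

lemma regular_at_inf_deriv_rf:
  assumes D: "derivation_over \<iota> D" and f: "regular_at_inf f"
  shows "regular_at_inf (deriv_rf D f)"
proof -
  obtain a b where b: "b \<noteq> 0" "degree a \<le> degree b" and f: "f = of_poly a / of_poly b"
    using f by (auto simp: regular_at_inf_conv)
  have 1: "deriv_rf D f = of_poly (map_poly D a * b - a * map_poly D b) / of_poly (b ^ 2)"
    unfolding f by (simp add: deriv_rf_quotient[OF D b(1)] of_poly_distribs power2_eq_square)
  have "degree (b ^ 2) = degree b + degree b" using b(1) by (simp add: degree_power_eq)
  moreover have "degree (map_poly D a * b) \<le> degree b + degree b" "degree (a * map_poly D b) \<le> degree b + degree b"
    using degree_mult_le[of "map_poly D a" b] degree_mult_le[of a "map_poly D b"]
      degree_map_poly_le[of D a] degree_map_poly_le[of D b] b(2) by linarith+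
  ultimately show ?thesis unfolding 1
    using b(1) by (intro regular_at_infI) (auto intro: degree_diff_le)
qed

lemma value_at_inf_inverse_s_var:
  "regular_at_inf (inverse s_var :: 'a::field ratfun)" "value_at_inf (inverse s_var) = (0 :: 'a)"
proof -
  have "inverse s_var = of_poly 1 / of_poly [:0, 1 :: 'a:]" by (simp add: s_var_def inverse_eq_divide)
  then show "regular_at_inf (inverse s_var :: 'a ratfun)" "value_at_inf (inverse s_var) = (0 :: 'a)"
    using regular_at_infI[of "[:0, 1 :: 'a:]" 1] value_at_inf_quotient[of "[:0, 1 :: 'a:]" 1]
    by simp_all
qed

lemma s_var_power: "s_var ^ n = of_poly (monom 1 n)"
  by (simp add: s_var_def monom_altdef flip: of_poly.hom_power)

lemma s_var_nonzero [simp]: "s_var \<noteq> 0"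
  by (simp add: s_var_def)

text \<open>
  This lemma and the next one are used with \<open>e\<close> a coefficient of the characteristic polynomial. The
  factor \<open>f\<close> is the same coefficient for a matrix that is regular at the point in question, so its
  value there is computed from the value of that matrix.
\<close>
lemma degree_le_of_regular_at_inf:
  assumes e: "of_poly e = s_var ^ n * f" and f: "regular_at_inf f"
  shows "degree e \<le> n" "coeff e n = value_at_inf f"
proof -
  obtain a b where b: "b \<noteq> 0" "degree a \<le> degree b" and ab: "f = of_poly a / of_poly b"
    using f by (auto simp: regular_at_inf_conv)
  have "of_poly (e * b) = of_poly (monom 1 n * a)"
    using b(1) e by (simp add: of_poly_distribs ab s_var_power)
  then have eb: "e * b = monom 1 n * a" by simp
  show le: "degree e \<le> n"
  proof (cases "e = 0")
    case False
    then have "degree e + degree b = degree (monom 1 n * a)"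
      using b(1) by (simp flip: eb add: degree_mult_eq)
    also have "\<dots> \<le> n + degree a"
      using degree_mult_le[of "monom 1 n" a] degree_monom_le[of 1 n] by (meson add_right_mono order.trans)
    finally show ?thesis using b(2) by simp
  qed simp
  have "f = of_poly e / of_poly (monom 1 n)"
    using e by (simp flip: s_var_power)
  then show "coeff e n = value_at_inf f"
    using value_at_inf_quotient[of "monom 1 n" e] le by (simp add: degree_monom_eq monom_eq_0_iff)
qed

lemma monom_dvd_of_regular_at_0:
  assumes e: "of_poly e = s_var ^ n * f" and f: "regular_at_0 f"
  shows "monom 1 n dvd e" "coeff e n = value_at_0 f"
proof -
  obtain a b where b: "poly b 0 \<noteq> 0" and ab: "f = of_poly a / of_poly b"
    using f by (auto simp: regular_at_0_conv)
  have b0: "b \<noteq> 0" using b by auto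
  have "of_poly (e * b) = of_poly (monom 1 n * a)"
    using b0 e by (simp add: of_poly_distribs ab s_var_power)
  then have eb: "e * b = monom 1 n * a" by simp
  show dvd: "monom 1 n dvd e"
  proof (cases "e = 0")
    case False
    have "monom 1 n dvd e * b" by (simp add: eb)
    then have "n \<le> order 0 (e * b)" using False b0 by (simp add: monom_1_dvd_iff)
    also have "\<dots> = order 0 e" using False b0 b by (simp add: order_mult order_0I)
    finally show ?thesis using False by (simp add: monom_1_dvd_iff)
  qed simp
  then obtain e' where e': "e = monom 1 n * e'" by (auto elim: dvdE)
  have "s_var ^ n * of_poly e' = s_var ^ n * f"
    using e by (simp add: e' of_poly_distribs s_var_power)
  then have "f = of_poly e' / of_poly 1" by simp
  then have "value_at_0 f = poly e' 0" using value_at_0_quotient[of 1 e'] by simp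
  then show "coeff e n = value_at_0 f" by (simp add: e' coeff_monom_mult poly_0_coeff_0)
qed

section \<open>Shift-invariant polynomials\<close>

lemma shift_invariant_poly_of_nat:
  fixes e :: "'a::comm_ring_1 poly"
  assumes "e \<circ>\<^sub>p [:1, 1:] = e"
  shows "poly e (of_nat k) = poly e 0"
proof (induction k)
  case (Suc k)
  have "poly e (of_nat k) = poly (e \<circ>\<^sub>p [:1, 1:]) (of_nat k)" by (simp add: assms)
  then show ?case using Suc by (simp add: poly_pcompose add.commute)
qed simp

lemma degree_artin_schreier:
  assumes "p > 1"
  shows "degree ([:0, 1:] - monom 1 p :: 'a::field poly) = p"
  using degree_add_eq_right[of "[:0, 1:]" "- monom 1 p :: 'a poly"] assms
  by (simp add: degree_monom_eq)

lemma artin_schreier_nonzero: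
  "p > 1 \<Longrightarrow> [:0, 1:] - monom 1 p \<noteq> (0 :: 'a::field poly)"
  using degree_artin_schreier[of p, where ?'a = 'a] by (metis degree_0 not_one_less_zero)

lemma artin_schreier_factor:
  assumes "p > 1"
  shows "[:0, 1:] - monom 1 p = monom 1 1 * (1 - monom 1 (p - 1) :: 'a::field poly)"
proof -
  have "[:0, 1:] = (monom 1 1 :: 'a poly)" by (simp add: monom_altdef)
  then show ?thesis using assms by (simp add: right_diff_distrib mult_monom)
qed

text \<open>
  A shift-invariant polynomial that vanishes at \<open>0\<close> has all \<open>p\<close> elements of the prime field as roots,
  so its remainder modulo \<open>s - s\<^sup>p\<close> is zero. The quotient is shift-invariant, its degree has
  dropped by \<open>p\<close> and its order of vanishing at \<open>0\<close> by one, so the argument can be repeated until the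
  degree is zero.
\<close>
lemma shift_invariant_poly_eq:
  fixes e :: "'a::field poly"
  assumes p: "prime p" "CHAR('a) = p"
    and "e \<circ>\<^sub>p [:1, 1:] = e" "degree e \<le> p * n" "monom 1 n dvd e"
  shows "\<exists>c. e = Polynomial.smult c (([:0, 1:] - monom 1 p) ^ n)"
  using assms(3-5)
proof (induction n arbitrary: e)
  case 0
  then obtain c where "e = [:c:]" by (auto elim: degree_eq_zeroE)
  then show ?case by (intro exI[of _ c]) simp
next
  case (Suc n)
  let ?u = "[:0, 1:] - monom 1 p :: 'a poly"
  have p1: "p > 1" using p(1) by (rule prime_gt_1_nat)
  have u: "?u \<circ>\<^sub>p [:1, 1:] = ?u"
  proof -
    have "monom 1 p \<circ>\<^sub>p [:1, 1:] = ([:1:] + monom 1 1 :: 'a poly) ^ p"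
      by (simp add: monom_altdef pcompose_hom.hom_power pcompose_pCons)
    also have "\<dots> = [:1:] ^ p + monom 1 1 ^ p" using p by (intro freshmans_dream) auto
    finally show ?thesis by (simp add: pcompose_diff pcompose_pCons monom_power poly_const_pow one_pCons)
  qed
  have degu: "degree ?u = p"
    using p1 by (rule degree_artin_schreier)
  have u0: "?u \<noteq> 0" using p1 by (rule artin_schreier_nonzero)
  have pu: "poly ?u 0 = 0" using p1 by (simp add: poly_monom)
  have pe: "poly e 0 = 0"
    using Suc.prems(3) by (auto simp: monom_1_dvd_iff' poly_0_coeff_0)
  define r where "r = e mod ?u"
  have "r = 0"
  proof (rule ccontr)
    assume r0: "r \<noteq> 0"
    have "poly r (of_nat k) = 0" for k
      using shift_invariant_poly_of_nat[OF Suc.prems(1), of k] shift_invariant_poly_of_nat[OF u, of k] pu pe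
      unfolding r_def by (simp add: poly_mod)
    then have "of_nat ` {..<p} \<subseteq> {x. poly r x = 0}" by auto
    moreover have "inj_on (of_nat :: nat \<Rightarrow> 'a) {..<p}"
    proof (rule inj_onI)
      fix x y assume xy: "x \<in> {..<p}" "y \<in> {..<p}" "of_nat x = (of_nat y :: 'a)"
      have "of_nat (y - x) = (0 :: 'a)" "of_nat (x - y) = (0 :: 'a)"
        using xy(3) by (cases "x \<le> y"; simp add: of_nat_diff)+
      then have "p dvd y - x" "p dvd x - y" using p(2) by (auto simp: of_nat_eq_0_iff_char_dvd)
      then show "x = y" using xy(1,2) by (auto dest!: dvd_imp_le split: nat_diff_split)
    qed
    ultimately have "p \<le> card {x. poly r x = 0}"
      using card_mono[OF poly_roots_finite[OF r0]] by (metis card_image card_lessThan)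
    also have "\<dots> \<le> degree r" using r0 by (rule card_poly_roots_bound)
    also have "\<dots> < p" using degree_mod_less[OF u0, of e] r0 p1 degu by (simp add: r_def)
    finally show False by simp
  qed
  then obtain q where q: "e = ?u * q" unfolding r_def by (metis dvdE mod_0_imp_dvd)
  have "?u * (q \<circ>\<^sub>p [:1, 1:]) = ?u * q"
    using Suc.prems(1) u unfolding q by (simp add: pcompose_mult)
  then have qinv: "q \<circ>\<^sub>p [:1, 1:] = q" using u0 by simp
  have degq: "degree q \<le> p * n"
  proof (cases "q = 0")
    case False
    then have "degree e = p + degree q" using u0 degu by (simp add: q degree_mult_eq)
    then show ?thesis using Suc.prems(2) by simp
  qed simp
  have "monom 1 n dvd q"
  proof (cases "q = 0")
    case False
    have "?u = monom 1 1 * (1 - monom 1 (p - 1))"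
      using p1 by (rule artin_schreier_factor)
    moreover have "poly (1 - monom 1 (p - 1)) 0 = (1 :: 'a)" using p1 by (simp add: poly_monom)
    then have "order 0 (1 - monom 1 (p - 1) :: 'a poly) = 0" by (intro order_0I) simp
    moreover have "order 0 (monom 1 1 :: 'a poly) = 1"
      using order_power_n_n[of "0 :: 'a" 1] by (simp add: monom_altdef)
    ultimately have "order 0 ?u = 1" using u0 by (metis add.right_neutral order_mult)
    moreover have "Suc n \<le> order 0 (?u * q)"
      using Suc.prems(3) False u0 by (simp add: q monom_1_dvd_iff)
    ultimately have "n \<le> order 0 q" using False u0 by (simp add: order_mult)
    then show ?thesis using False by (simp add: monom_1_dvd_iff)
  qed simp
  from Suc.IH[OF qinv degq this] obtain c where "q = Polynomial.smult c (?u ^ n)" by auto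
  then show ?case by (intro exI[of _ c]) (simp add: q)
qed

lemma coeff_artin_schreier_power:
  assumes "p > 1"
  shows "coeff (([:0, 1:] - monom 1 p :: 'a::field poly) ^ n) n = 1"
    "coeff (([:0, 1:] - monom 1 p :: 'a::field poly) ^ n) (p * n) = (- 1) ^ n"
proof -
  let ?u = "[:0, 1:] - monom 1 p :: 'a poly"
  have "?u = monom 1 1 * (1 - monom 1 (p - 1))"
    using assms by (rule artin_schreier_factor)
  then have "?u ^ n = monom 1 n * (1 - monom 1 (p - 1)) ^ n"
    by (simp add: power_mult_distrib monom_power)
  then have "coeff (?u ^ n) n = poly ((1 - monom 1 (p - 1)) ^ n) 0"
    by (simp add: coeff_monom_mult poly_0_coeff_0)
  then show "coeff (?u ^ n) n = 1" using assms by (simp add: poly_monom power_0_left)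
  have "degree ?u = p"
    using assms by (rule degree_artin_schreier)
  moreover from this have "lead_coeff ?u = - 1"
    using assms by (simp add: coeff_pCons split: nat.splits)
  moreover have "degree (?u ^ n) = n * degree ?u"
  proof -
    have "?u \<noteq> 0" using assms by (rule artin_schreier_nonzero)
    then show ?thesis by (simp add: degree_power_eq)
  qed
  ultimately show "coeff (?u ^ n) (p * n) = (- 1) ^ n"
    by (metis lead_coeff_power mult.commute)
qed

section \<open>The characteristic polynomial of the \<open>p\<close>-curvature\<close>

text \<open>
  Dividing by one factor \<open>s\<close> per step, the recursion becomes
  \<open>F\<^sub>n\<^sub>+\<^sub>1 = \<partial> F\<^sub>n / s - B F\<^sub>n\<close>, and the first term vanishes at infinity.
\<close>
lemma covariant_power_at_inf:
  fixes D :: "'K::field \<Rightarrow> 'K"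
  assumes D: "derivation_over \<iota> D" and B: "B \<in> carrier_mat N N"
    and reg: "\<forall>f\<in>elements_mat B. regular_at_inf f"
  shows "\<exists>F. F \<in> carrier_mat N N \<and> elements_mat F \<subseteq> {f. regular_at_inf f} \<and>
    covariant_power (deriv_rf D) (s_var \<cdot>\<^sub>m B) n = (s_var ^ n) \<cdot>\<^sub>m F \<and>
    map_mat value_at_inf F = (- map_mat value_at_inf B) ^\<^sub>m n"
proof (induction n)
  interpret v: subring_hom "{f::'K ratfun. regular_at_inf f}" value_at_inf
    by (rule subring_hom_value_at_inf)
  interpret d: derivation "deriv_rf D" using D by (rule derivation_deriv_rf)
  {
    case 0
    have "map_mat value_at_inf (1\<^sub>m N) = (1\<^sub>m N :: 'K mat)"
      by (intro eq_matI) (auto simp: v.one v.zero)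
    moreover have "elements_mat (1\<^sub>m N) \<subseteq> {f::'K ratfun. regular_at_inf f}"
      using v.one(1) v.zero(1) by (intro elements_mat_subsetI[of _ N N]) auto
    ultimately show ?case using B by (intro exI[of _ "1\<^sub>m N"]) auto
  next
    case (Suc n)
    then obtain F where F: "F \<in> carrier_mat N N" "elements_mat F \<subseteq> {f. regular_at_inf f}"
      and C: "covariant_power (deriv_rf D) (s_var \<cdot>\<^sub>m B) n = (s_var ^ n) \<cdot>\<^sub>m F"
      and vF: "map_mat value_at_inf F = (- map_mat value_at_inf B) ^\<^sub>m n"
      by blast
    have regB: "elements_mat B \<subseteq> {f. regular_at_inf f}" using reg by auto
    have BF: "B * F \<in> carrier_mat N N" "elements_mat (B * F) \<subseteq> {f. regular_at_inf f}"
      "map_mat value_at_inf (B * F) = map_mat value_at_inf B * map_mat value_at_inf F"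
      using v.mult_mat[OF B F(1) regB F(2)] B F(1) by auto
    define F' where "F' = inverse s_var \<cdot>\<^sub>m map_mat (deriv_rf D) F - B * F"
    have F': "F' \<in> carrier_mat N N" using BF(1) by (simp add: F'_def minus_carrier_mat)
    have F'_entry: "F' $$ (i, j) = inverse s_var * deriv_rf D (F $$ (i, j)) - (B * F) $$ (i, j)"
      if "i < N" "j < N" for i j
      using that B F by (simp add: F'_def del: index_mult_mat(1))
    have in_R: "inverse s_var * deriv_rf D (F $$ (i, j)) \<in> {f. regular_at_inf f}"
      "value_at_inf (inverse s_var * deriv_rf D (F $$ (i, j))) = 0"
      "(B * F) $$ (i, j) \<in> {f. regular_at_inf f}" if "i < N" "j < N" for i j
    proof -
      have "F $$ (i, j) \<in> {f. regular_at_inf f}" using that by (rule elements_mat_subsetD[OF F(2,1)])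
      then have d: "deriv_rf D (F $$ (i, j)) \<in> {f. regular_at_inf f}"
        using regular_at_inf_deriv_rf[OF D] by simp
      have s: "inverse s_var \<in> {f::'K ratfun. regular_at_inf f}"
        using value_at_inf_inverse_s_var by simp
      show "inverse s_var * deriv_rf D (F $$ (i, j)) \<in> {f. regular_at_inf f}"
        using s d by (rule v.mult)
      show "value_at_inf (inverse s_var * deriv_rf D (F $$ (i, j))) = 0"
        using v.mult(2)[OF s d] value_at_inf_inverse_s_var(2)[where ?'a = 'K] by simp
      show "(B * F) $$ (i, j) \<in> {f. regular_at_inf f}"
        using that by (rule elements_mat_subsetD[OF BF(2,1)])
    qed
    have "elements_mat F' \<subseteq> {f. regular_at_inf f}"
    proof (rule elements_mat_subsetI[OF F'])
      fix i j assume ij: "i < N" "j < N"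
      show "F' $$ (i, j) \<in> {f. regular_at_inf f}"
        unfolding F'_entry[OF ij] using in_R[OF ij] by (intro v.diff) auto
    qed
    moreover have "map_mat value_at_inf F' = (- map_mat value_at_inf B) ^\<^sub>m Suc n"
    proof -
      have "map_mat value_at_inf F' = - map_mat value_at_inf (B * F)"
      proof (rule eq_matI)
        fix i j assume "i < dim_row (- map_mat value_at_inf (B * F))" "j < dim_col (- map_mat value_at_inf (B * F))"
        then have ij: "i < N" "j < N" using BF(1) by auto
        show "map_mat value_at_inf F' $$ (i, j) = (- map_mat value_at_inf (B * F)) $$ (i, j)"
          using ij F' carrier_matD[OF BF(1)] v.diff(2)[OF in_R(1,3)[OF ij]] in_R(2)[OF ij]
          by (simp add: F'_entry del: index_mult_mat)
      qed (use F' BF(1) in auto)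
      also have "\<dots> = - map_mat value_at_inf B * map_mat value_at_inf F"
        unfolding BF(3) using B F by simp
      also have "\<dots> = (- map_mat value_at_inf B) ^\<^sub>m Suc n"
        unfolding vF using B by (subst pow_mat_Suc_left[of _ N]) auto
      finally show ?thesis .
    qed
    moreover have "covariant_power (deriv_rf D) (s_var \<cdot>\<^sub>m B) (Suc n) = (s_var ^ Suc n) \<cdot>\<^sub>m F'"
    proof -
      have "deriv_rf D (s_var ^ n) = 0"
        by (induction n) (simp_all add: d.mult deriv_rf_s_var[OF D])
      then have ds: "deriv_rf D (s_var ^ n * f) = s_var ^ n * deriv_rf D f" for f
        by (simp add: d.mult)
      have sBF: "s_var \<cdot>\<^sub>m B * (s_var ^ n \<cdot>\<^sub>m F) = s_var \<cdot>\<^sub>m (s_var ^ n \<cdot>\<^sub>m (B * F))"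
        using mult_smult_assoc_mat[OF B, of "s_var ^ n \<cdot>\<^sub>m F" N s_var]
          mult_smult_distrib[OF B F(1), of "s_var ^ n"] F(1) by simp
      show ?thesis
      proof (rule eq_matI)
        fix i j assume "i < dim_row (s_var ^ Suc n \<cdot>\<^sub>m F')" "j < dim_col (s_var ^ Suc n \<cdot>\<^sub>m F')"
        then have ij: "i < N" "j < N" using F' by auto
        have "covariant_power (deriv_rf D) (s_var \<cdot>\<^sub>m B) (Suc n) $$ (i, j) =
            deriv_rf D (s_var ^ n * F $$ (i, j)) - s_var * (s_var ^ n * (B * F) $$ (i, j))"
          unfolding covariant_power.simps C sBF using F(1) carrier_matD[OF BF(1)] ij
          by (simp del: index_mult_mat(1))
        also have "\<dots> = s_var ^ Suc n * F' $$ (i, j)"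
          unfolding ds F'_entry[OF ij] by (simp add: right_diff_distrib)
        finally show "covariant_power (deriv_rf D) (s_var \<cdot>\<^sub>m B) (Suc n) $$ (i, j) =
            (s_var ^ Suc n \<cdot>\<^sub>m F') $$ (i, j)" using F' ij by simp
      qed (use F' C F(1) carrier_matD[OF BF(1)] sBF in auto)
    qed
    ultimately show ?case using F' by blast
  }
qed

text \<open>
  After the first step, which yields \<open>- s B\<close>, the recursion divided by \<open>s\<close> is
  \<open>F\<^sub>n\<^sub>+\<^sub>1 = \<partial> F\<^sub>n - s B F\<^sub>n\<close>, and the second term vanishes at \<open>0\<close>.
\<close>
lemma covariant_power_at_0:
  fixes D :: "'K::field \<Rightarrow> 'K"
  assumes D: "derivation_over \<iota> D" and B: "B \<in> carrier_mat N N"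
    and reg: "\<forall>f\<in>elements_mat B. regular_at_0 f"
  shows "\<exists>F. F \<in> carrier_mat N N \<and> elements_mat F \<subseteq> {f. regular_at_0 f} \<and>
    covariant_power (deriv_rf D) (s_var \<cdot>\<^sub>m B) (Suc n) = s_var \<cdot>\<^sub>m F \<and>
    map_mat value_at_0 F = - map_mat (D ^^ n) (map_mat value_at_0 B)"
proof (induction n)
  interpret v: subring_hom "{f::'K ratfun. regular_at_0 f}" value_at_0
    by (rule subring_hom_value_at_0)
  interpret K: derivation D using D by (rule derivation_over_imp_derivation)
  interpret d: derivation "deriv_rf D" using D by (rule derivation_deriv_rf)
  have regB: "elements_mat B \<subseteq> {f. regular_at_0 f}" using reg by auto
  {
    case 0
    have regB': "B $$ (i, j) \<in> {f. regular_at_0 f}" if "i < N" "j < N" for i j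
      using that by (rule elements_mat_subsetD[OF regB B])
    have "elements_mat (- B) \<subseteq> {f. regular_at_0 f}"
      using B regB' v.uminus(1) by (intro elements_mat_subsetI[of _ N N]) auto
    moreover have "map_mat value_at_0 (- B) = - map_mat value_at_0 B"
      using B regB' v.uminus(2) by (intro eq_matI) auto
    moreover have "map_mat (deriv_rf D) (1\<^sub>m N) - s_var \<cdot>\<^sub>m B = s_var \<cdot>\<^sub>m (- B)"
      using B by (intro eq_matI) auto
    ultimately show ?case using B by (intro exI[of _ "- B"]) (auto simp flip: id_def)
  next
    case (Suc n)
    then obtain F where F: "F \<in> carrier_mat N N" "elements_mat F \<subseteq> {f. regular_at_0 f}"
      and C: "covariant_power (deriv_rf D) (s_var \<cdot>\<^sub>m B) (Suc n) = s_var \<cdot>\<^sub>m F"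
      and vF: "map_mat value_at_0 F = - map_mat (D ^^ n) (map_mat value_at_0 B)"
      by blast
    have BF: "B * F \<in> carrier_mat N N" "elements_mat (B * F) \<subseteq> {f. regular_at_0 f}"
      using v.mult_mat[OF B F(1) regB F(2)] B F(1) by auto
    define F' where "F' = map_mat (deriv_rf D) F - s_var \<cdot>\<^sub>m (B * F)"
    have F': "F' \<in> carrier_mat N N" using BF(1) by (simp add: F'_def minus_carrier_mat)
    have F'_entry: "F' $$ (i, j) = deriv_rf D (F $$ (i, j)) - s_var * (B * F) $$ (i, j)"
      if "i < N" "j < N" for i j
      using that B F by (simp add: F'_def del: index_mult_mat(1))
    have s: "s_var \<in> {f::'K ratfun. regular_at_0 f}" "value_at_0 (s_var :: 'K ratfun) = 0"
      using regular_at_0I[of 1 "[:0, 1 :: 'K:]"] value_at_0_quotient[of 1 "[:0, 1 :: 'K:]"]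
      by (simp_all add: s_var_def)
    have in_R: "deriv_rf D (F $$ (i, j)) \<in> {f. regular_at_0 f}"
      "value_at_0 (deriv_rf D (F $$ (i, j))) = D (value_at_0 (F $$ (i, j)))"
      "s_var * (B * F) $$ (i, j) \<in> {f. regular_at_0 f}"
      "value_at_0 (s_var * (B * F) $$ (i, j)) = 0" if "i < N" "j < N" for i j
    proof -
      have "F $$ (i, j) \<in> {f. regular_at_0 f}" using that by (rule elements_mat_subsetD[OF F(2,1)])
      then show "deriv_rf D (F $$ (i, j)) \<in> {f. regular_at_0 f}"
        "value_at_0 (deriv_rf D (F $$ (i, j))) = D (value_at_0 (F $$ (i, j)))"
        using value_at_0_deriv_rf[OF D] by simp_all
      have "(B * F) $$ (i, j) \<in> {f. regular_at_0 f}"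
        using that by (rule elements_mat_subsetD[OF BF(2,1)])
      with s show "s_var * (B * F) $$ (i, j) \<in> {f. regular_at_0 f}"
        "value_at_0 (s_var * (B * F) $$ (i, j)) = 0"
        using v.mult by (metis, metis mult_zero_left)
    qed
    have "elements_mat F' \<subseteq> {f. regular_at_0 f}"
    proof (rule elements_mat_subsetI[OF F'])
      fix i j assume ij: "i < N" "j < N"
      show "F' $$ (i, j) \<in> {f. regular_at_0 f}"
        unfolding F'_entry[OF ij] using in_R(1,3)[OF ij] by (rule v.diff)
    qed
    moreover have "map_mat value_at_0 F' = - map_mat (D ^^ Suc n) (map_mat value_at_0 B)"
    proof (rule eq_matI)
      fix i j assume "i < dim_row (- map_mat (D ^^ Suc n) (map_mat value_at_0 B))"
        "j < dim_col (- map_mat (D ^^ Suc n) (map_mat value_at_0 B))"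
      then have ij: "i < N" "j < N" using B by auto
      have "value_at_0 (F' $$ (i, j)) = D (map_mat value_at_0 F $$ (i, j))"
        unfolding F'_entry[OF ij] v.diff(2)[OF in_R(1,3)[OF ij]] using in_R(2,4)[OF ij] F(1) ij by simp
      then show "map_mat value_at_0 F' $$ (i, j) = (- map_mat (D ^^ Suc n) (map_mat value_at_0 B)) $$ (i, j)"
        using ij F' B by (simp add: vF K.minus)
    qed (use F' B in auto)
    moreover have "covariant_power (deriv_rf D) (s_var \<cdot>\<^sub>m B) (Suc (Suc n)) = s_var \<cdot>\<^sub>m F'"
    proof -
      have sBF: "s_var \<cdot>\<^sub>m B * (s_var \<cdot>\<^sub>m F) = s_var \<cdot>\<^sub>m (s_var \<cdot>\<^sub>m (B * F))"
        using mult_smult_assoc_mat[OF B, of "s_var \<cdot>\<^sub>m F" N s_var]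
          mult_smult_distrib[OF B F(1), of s_var] F(1) by simp
      show ?thesis
      proof (rule eq_matI)
        fix i j assume "i < dim_row (s_var \<cdot>\<^sub>m F')" "j < dim_col (s_var \<cdot>\<^sub>m F')"
        then have ij: "i < N" "j < N" using F' by auto
        have "covariant_power (deriv_rf D) (s_var \<cdot>\<^sub>m B) (Suc (Suc n)) $$ (i, j) =
            deriv_rf D (s_var * F $$ (i, j)) - s_var * (s_var * (B * F) $$ (i, j))"
          unfolding covariant_power.simps(2)[of _ _ "Suc n"] C sBF using F(1) carrier_matD[OF BF(1)] ij
          by (simp del: index_mult_mat(1))
        also have "\<dots> = s_var * F' $$ (i, j)"
          unfolding F'_entry[OF ij] by (simp add: right_diff_distrib d.mult deriv_rf_s_var[OF D])
        finally show "covariant_power (deriv_rf D) (s_var \<cdot>\<^sub>m B) (Suc (Suc n)) $$ (i, j) =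
            (s_var \<cdot>\<^sub>m F') $$ (i, j)" using F' ij by simp
      qed (use F' C F(1) carrier_matD[OF BF(1)] sBF in auto)
    qed
    ultimately show ?case using F' by blast
  }
qed

lemma map_poly_derivation_pcompose_shift:
  assumes "derivation d"
  shows "map_poly d (a \<circ>\<^sub>p [:1, 1:]) = map_poly d a \<circ>\<^sub>p [:1, 1:]"
proof -
  interpret derivation d by fact
  interpret m: derivation "map_poly d" by (rule map_poly_derivation)
  have c: "map_poly d [:c:] = [:d c:]" for c
    by (rule poly_eqI) (simp add: coeff_map_poly coeff_pCons split: nat.splits)
  have s: "map_poly d [:1, 1:] = 0"
    by (rule poly_eqI) (simp add: coeff_map_poly coeff_pCons split: nat.splits)
  show ?thesis
  proof (induction a)
    case (pCons c a)
    have "map_poly d (pCons c a) = pCons (d c) (map_poly d a)"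
      by (rule poly_eqI) (simp add: coeff_map_poly coeff_pCons split: nat.splits)
    then show ?case unfolding pcompose_pCons m.add m.mult c s pCons.IH
      by (simp add: pcompose_pCons)
  qed simp
qed

lemma p_curvature_conv_covariant_power:
  assumes D: "derivation_over \<iota> D" and B: "B \<in> carrier_mat N N"
    and p: "prime p" "CHAR('K) = p" and Dp: "\<And>z::'K::field. (D ^^ p) z = 0"
  shows "p_curvature D p N B = covariant_power (deriv_rf D) (rf_mat B) p"
proof (rule eq_matI)
  interpret d: derivation "deriv_rf D" using D by (rule derivation_deriv_rf)
  have B': "rf_mat B \<in> carrier_mat N N" using B by (simp add: rf_mat_def)
  have p': "CHAR('K ratfun) = p" using p(2) by (simp add: CHAR_ratfun)
  let ?C = "covariant_power (deriv_rf D) (rf_mat B) p"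
  have C: "?C \<in> carrier_mat N N" using B' by simp
  show "dim_row (p_curvature D p N B) = dim_row ?C" "dim_col (p_curvature D p N B) = dim_col ?C"
    using C by (simp_all add: p_curvature_def)
  fix i j assume "i < dim_row ?C" "j < dim_col ?C"
  then have ij: "i < N" "j < N" using C by auto
  show "p_curvature D p N B $$ (i, j) = ?C $$ (i, j)"
    using ij C d.conn_funpow_CHAR[OF B' unit_vec_carrier p(1) p' deriv_rf_funpow_CHAR[OF D p Dp]]
    by (simp add: p_curvature_def nabla_conv_conn mult_mat_unit_vec)
qed

lemma char_poly_gauge_equivalent:
  assumes D: "derivation_over \<iota> D" and p: "prime p" "CHAR('K) = p"
    and Dp: "\<And>z::'K::field. (D ^^ p) z = 0"
    and M: "M \<in> carrier_mat N N" "M' \<in> carrier_mat N N"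
    and "gauge_equivalent D N M M'"
  shows "char_poly (covariant_power (deriv_rf D) M' p) = char_poly (covariant_power (deriv_rf D) M p)"
proof -
  interpret d: derivation "deriv_rf D" using D by (rule derivation_deriv_rf)
  obtain G H where "mutually_inverse N G H" "intertwines D N G M M'"
    using assms by (auto simp: gauge_equivalent_def)
  then show ?thesis
    using d.char_poly_covariant_power_CHAR_gauge[OF M, of G H p] p deriv_rf_funpow_CHAR[OF D p Dp]
    by (simp add: intertwines_def nabla_conv_conn CHAR_ratfun)
qed

text \<open>
  This is how the characteristic polynomial of the \<open>p\<close>-curvature is recognized: the form of the
  coefficients assumed here is that of a constant matrix scaled by \<open>s - s\<^sup>p\<close>.
\<close>
lemma char_poly_smult_const_rf:
  fixes A :: "'K::field mat"
  assumes p: "p > 1" and C: "C \<in> carrier_mat N N" and A: "A \<in> carrier_mat N N"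
    and coeff: "\<And>i. i \<le> N \<Longrightarrow> coeff (char_poly C) i =
      of_poly (Polynomial.smult (coeff (char_poly A) i) (([:0, 1:] - monom 1 p) ^ (N - i)))"
  shows "char_poly C = char_poly ((s_var - s_var ^ p) \<cdot>\<^sub>m map_mat const_rf A)"
proof (rule char_poly_eqI[OF C])
  interpret c: comm_ring_hom "const_rf :: 'K \<Rightarrow> _"
    by standard (simp_all add: const_rf_def one_pCons flip: of_poly_distribs of_poly.hom_one)
  show A': "(s_var - s_var ^ p) \<cdot>\<^sub>m map_mat const_rf A \<in> carrier_mat N N" using A by simp
  fix i assume i: "i \<le> N"
  have u: "s_var - s_var ^ p = of_poly ([:0, 1:] - monom 1 p :: 'K poly)"
    unfolding s_var_power of_poly_distribs by (simp add: s_var_def)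
  have "[:0, 1:] - monom 1 p \<noteq> (0 :: 'K poly)"
    using p by (rule artin_schreier_nonzero)
  then have u0: "s_var - s_var ^ p \<noteq> (0 :: 'K ratfun)" unfolding u by simp
  have "coeff (char_poly ((s_var - s_var ^ p) \<cdot>\<^sub>m map_mat const_rf A)) i =
      (s_var - s_var ^ p) ^ (N - i) * const_rf (coeff (char_poly A) i)"
    using A i by (subst coeff_char_poly_smult[OF _ u0 i]) (auto simp: c.char_poly_hom)
  also have "\<dots> = of_poly ([:coeff (char_poly A) i:] * ([:0, 1:] - monom 1 p) ^ (N - i))"
    unfolding u const_rf_def of_poly.hom_mult of_poly.hom_power by (rule mult.commute)
  also have "[:coeff (char_poly A) i:] * ([:0, 1:] - monom 1 p) ^ (N - i) =
      Polynomial.smult (coeff (char_poly A) i) (([:0, 1:] - monom 1 p) ^ (N - i))" by simp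
  finally show "coeff (char_poly C) i = coeff (char_poly ((s_var - s_var ^ p) \<cdot>\<^sub>m map_mat const_rf A)) i"
    using coeff[OF i] by simp
qed

theorem theorem5p8:
  fixes \<iota> :: "'k::alg_closed_field \<Rightarrow> 'K::field"
    and X :: "'K set set" and x :: 'K and D :: "'K \<Rightarrow> 'K"
    and p N :: nat and B :: "'K poly mat"
    and Binf_s Bzero_s :: "'K ratfun mat" and Binf Bzero :: "'K mat"
  assumes "CHAR('k) = p" and "p > 0"
    and "smooth_curve \<iota> X" and "local_coordinate \<iota> X x" and "coordinate_derivation \<iota> x D"
    and "polynomial_family D X N B" and "periodic \<iota> D X N B"
    and "pseudo_pencil D N B Binf_s" and "Binf = map_mat value_at_inf Binf_s"
    and "trivializable_at_0 D N B Bzero_s" and "Bzero = map_mat value_at_0 Bzero_s"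
  shows "isospectral (p_curvature D p N B)
           ((s_var - s_var ^ p) \<cdot>\<^sub>m map_mat const_rf (frobenius_twist p Binf))
       \<and> isospectral (p_curvature D p N B)
           (- ((s_var - s_var ^ p) \<cdot>\<^sub>m map_mat const_rf (map_mat (D ^^ (p - 1)) Bzero)))
       \<and> isospectral (frobenius_twist p Binf) (- map_mat (D ^^ (p - 1)) Bzero)"
proof -
  have field: "function_field \<iota>" "field_hom \<iota>"
    using assms(3) by (auto simp: smooth_curve_def function_field_def)
  have p: "prime p" using assms(1,2) prime_CHAR_semidom[where ?'a = 'k] by simp
  have p1: "p > 1" using p by (rule prime_gt_1_nat)
  have pK: "CHAR('K) = p" using CHAR_field_hom[OF field(2)] assms(1) by simp
  have D: "derivation_over \<iota> D" using assms(5) by (simp add: coordinate_derivation_def)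
  have Dp: "(D ^^ p) z = 0" for z
    using coordinate_derivation_funpow_CHAR[OF field(1) p assms(1,5)] .
  interpret D: derivation D using D by (rule derivation_over_imp_derivation)
  interpret v0: subring_hom "{f::'K ratfun. regular_at_0 f}" value_at_0
    by (rule subring_hom_value_at_0)
  interpret vinf: subring_hom "{f::'K ratfun. regular_at_inf f}" value_at_inf
    by (rule subring_hom_value_at_inf)
  let ?d = "deriv_rf D"
  have B: "B \<in> carrier_mat N N" using assms(6) by (simp add: polynomial_family_def)
  have Binf: "Binf_s \<in> carrier_mat N N" "\<forall>f\<in>elements_mat Binf_s. regular_at_inf f"
    "gauge_equivalent D N (rf_mat B) (s_var \<cdot>\<^sub>m Binf_s)"
    using assms(8) by (auto simp: pseudo_pencil_def)
  have Bzero: "Bzero_s \<in> carrier_mat N N" "\<forall>f\<in>elements_mat Bzero_s. regular_at_0 f"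
    "gauge_equivalent D N (rf_mat B) (s_var \<cdot>\<^sub>m Bzero_s)"
    using assms(10) by (auto simp: trivializable_at_0_def)
  define P where "P = covariant_power (map_poly D) B p"
  have P: "P \<in> carrier_mat N N" using B by (simp add: P_def)
  have rfB: "rf_mat B \<in> carrier_mat N N" using B by (simp add: rf_mat_def)
  have C: "p_curvature D p N B = map_mat of_poly P"
    unfolding p_curvature_conv_covariant_power[OF D B p pK Dp] rf_mat_def P_def
    by (rule of_poly.covariant_power_hom[OF B]) (simp add: deriv_rf_of_poly[OF D])
  have Cpow: "covariant_power ?d (rf_mat B) p = map_mat of_poly P"
    using C p_curvature_conv_covariant_power[OF D B p pK Dp] by simp
  have CN: "p_curvature D p N B \<in> carrier_mat N N" using P by (simp add: C)
  have chC: "coeff (char_poly (p_curvature D p N B)) i = of_poly (coeff (char_poly P) i)" for i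
    by (simp add: C of_poly.char_poly_hom[OF P] coeff_map_poly)

  \<comment> \<open>Periodicity: the gauge transformation identifies the characteristic polynomial of
    the shifted \<open>P\<close> with that of \<open>P\<close>.\<close>
  have inv: "coeff (char_poly P) i \<circ>\<^sub>p [:1, 1:] = coeff (char_poly P) i" for i
  proof -
    have comm: "map_poly D a \<circ>\<^sub>p [:1, 1:] = map_poly D (a \<circ>\<^sub>p [:1, 1:])" for a
      by (rule map_poly_derivation_pcompose_shift[OF D.derivation_axioms, symmetric])
    have shB: "shift B \<in> carrier_mat N N" using B by (simp add: shift_def)
    have "covariant_power (map_poly D) (shift B) p = map_mat (\<lambda>q. q \<circ>\<^sub>p [:1, 1:]) P"
      unfolding shift_def P_def using comm_ring_hom.covariant_power_hom[OF pcompose_comm_ring_hom B,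
        of "map_poly D" "[:1, 1:]" "map_poly D" p] comm by simp
    moreover have "covariant_power ?d (rf_mat (shift B)) p =
        map_mat of_poly (covariant_power (map_poly D) (shift B) p)"
      unfolding rf_mat_def
      by (rule of_poly.covariant_power_hom[OF shB]) (simp add: deriv_rf_of_poly[OF D])
    ultimately have "char_poly (covariant_power ?d (rf_mat (shift B)) p) =
        map_poly of_poly (map_poly (\<lambda>q. q \<circ>\<^sub>p [:1, 1:]) (char_poly P))"
      using P by (simp add: of_poly.char_poly_hom[of _ N] comm_ring_hom.char_poly_hom[OF pcompose_comm_ring_hom, of _ N])
    moreover have "gauge_equivalent D N (rf_mat B) (rf_mat (shift B))"
      using assms(7) by (auto simp: periodic_def gauge_equivalent_def)
    then have "char_poly (covariant_power ?d (rf_mat (shift B)) p) = char_poly (map_mat of_poly P)"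
      using char_poly_gauge_equivalent[OF D p pK Dp rfB] shB Cpow by (simp add: rf_mat_def)
    ultimately have "map_poly of_poly (map_poly (\<lambda>q. q \<circ>\<^sub>p [:1, 1:]) (char_poly P)) =
        map_poly of_poly (char_poly P)"
      by (simp add: of_poly.char_poly_hom[OF P])
    from arg_cong[OF this, of "\<lambda>q. coeff q i"] show ?thesis by (simp add: coeff_map_poly)
  qed

  \<comment> \<open>The behaviour at infinity. The two signs of \<open>- Binf\<close> collapse since \<open>- 1\<close> is its own
    \<open>p\<close>-th power, also for \<open>p = 2\<close>.\<close>
  obtain F where F: "F \<in> carrier_mat N N" "elements_mat F \<subseteq> {f. regular_at_inf f}"
    "covariant_power ?d (s_var \<cdot>\<^sub>m Binf_s) p = (s_var ^ p) \<cdot>\<^sub>m F"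
    "map_mat value_at_inf F = (- Binf) ^\<^sub>m p"
    using covariant_power_at_inf[OF D Binf(1,2), of p] assms(9) by auto
  have coeff_inf: "degree (coeff (char_poly P) i) \<le> p * (N - i)"
    "coeff (coeff (char_poly P) i) (p * (N - i)) =
      (- 1) ^ (N - i) * coeff (char_poly (frobenius_twist p Binf)) i" if i: "i \<le> N" for i
  proof -
    have "char_poly ((s_var ^ p) \<cdot>\<^sub>m F) = char_poly (map_mat of_poly P)"
      using char_poly_gauge_equivalent[OF D p pK Dp rfB _ Binf(3)] Binf(1) Cpow by (simp add: F(3))
    then have "of_poly (coeff (char_poly P) i) = coeff (char_poly ((s_var ^ p) \<cdot>\<^sub>m F)) i"
      using chC C by simp
    also have "\<dots> = s_var ^ (p * (N - i)) * coeff (char_poly F) i"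
      by (subst coeff_char_poly_smult[OF F(1) _ i]) (auto simp: power_mult)
    finally have e: "of_poly (coeff (char_poly P) i) = \<dots>" .
    have reg: "regular_at_inf (coeff (char_poly F) i)" using vinf.char_poly(1)[OF F(1,2)] by simp
    show "degree (coeff (char_poly P) i) \<le> p * (N - i)" by (rule degree_le_of_regular_at_inf[OF e reg])
    have BN: "Binf \<in> carrier_mat N N" using Binf(1) assms(9) by simp
    have "coeff (coeff (char_poly P) i) (p * (N - i)) = coeff (char_poly ((- Binf) ^\<^sub>m p)) i"
      using degree_le_of_regular_at_inf(2)[OF e reg] vinf.char_poly(2)[OF F(1,2)] F(4) by simp
    also have "\<dots> = coeff (char_poly (- Binf)) i ^ p"
      using char_poly_pow_CHAR[OF _ p pK, of "- Binf" N] BN p1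
      by (simp add: coeff_map_poly power_0_left)
    also have "coeff (char_poly (- Binf)) i = (- 1) ^ (N - i) * coeff (char_poly Binf) i"
    proof -
      have "- Binf = (- 1) \<cdot>\<^sub>m Binf" by (intro eq_matI) auto
      then show ?thesis using coeff_char_poly_smult[OF BN _ i, of "- 1"] by simp
    qed
    also have "((- 1) ^ (N - i) * coeff (char_poly Binf) i) ^ p =
        (- 1) ^ (N - i) * coeff (char_poly Binf) i ^ p"
    proof -
      have "((- 1) ^ (N - i)) ^ p = ((- 1) ^ p :: 'K) ^ (N - i)" by (simp flip: power_mult add: mult.commute)
      also have "(- 1 :: 'K) ^ p = - 1" using minus_power_prime_CHAR[of p "1 :: 'K"] p pK by simp
      finally show ?thesis by (simp add: power_mult_distrib)
    qed
    also have "coeff (char_poly Binf) i ^ p = coeff (char_poly (frobenius_twist p Binf)) i"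
      using char_poly_frobenius_twist[OF BN p pK] p1
      by (simp add: coeff_map_poly power_0_left)
    finally show "coeff (coeff (char_poly P) i) (p * (N - i)) =
      (- 1) ^ (N - i) * coeff (char_poly (frobenius_twist p Binf)) i" .
  qed

  \<comment> \<open>The behaviour at \<open>0\<close>: the first of the \<open>p\<close> steps produces the factor \<open>s\<close>, the other
    \<open>p - 1\<close> differentiate.\<close>
  define Z where "Z = - map_mat (D ^^ (p - 1)) Bzero"
  obtain E where E: "E \<in> carrier_mat N N" "elements_mat E \<subseteq> {f. regular_at_0 f}"
    "covariant_power ?d (s_var \<cdot>\<^sub>m Bzero_s) p = s_var \<cdot>\<^sub>m E" "map_mat value_at_0 E = Z"
    using covariant_power_at_0[OF D Bzero(1,2), of "p - 1"] assms(11) p1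
    by (auto simp: Z_def simp del: covariant_power.simps)
  have coeff_0: "monom 1 (N - i) dvd coeff (char_poly P) i"
    "coeff (coeff (char_poly P) i) (N - i) = coeff (char_poly Z) i" if i: "i \<le> N" for i
  proof -
    have "char_poly (s_var \<cdot>\<^sub>m E) = char_poly (map_mat of_poly P)"
      using char_poly_gauge_equivalent[OF D p pK Dp rfB _ Bzero(3)] Bzero(1) Cpow by (simp add: E(3))
    then have "of_poly (coeff (char_poly P) i) = coeff (char_poly (s_var \<cdot>\<^sub>m E)) i"
      using chC C by simp
    also have "\<dots> = s_var ^ (N - i) * coeff (char_poly E) i"
      by (rule coeff_char_poly_smult[OF E(1) _ i]) simp
    finally have e: "of_poly (coeff (char_poly P) i) = \<dots>" .
    have reg: "regular_at_0 (coeff (char_poly E) i)" using v0.char_poly(1)[OF E(1,2)] by simp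
    show "monom 1 (N - i) dvd coeff (char_poly P) i" by (rule monom_dvd_of_regular_at_0[OF e reg])
    show "coeff (coeff (char_poly P) i) (N - i) = coeff (char_poly Z) i"
      using monom_dvd_of_regular_at_0(2)[OF e reg] v0.char_poly(2)[OF E(1,2)] E(4) by simp
  qed

  \<comment> \<open>Comparing the lowest coefficient determines the constant, and comparing the highest one
    relates it to the twist of \<open>Binf\<close>; the sign cancels against that of \<open>- s\<^sup>p\<close>.\<close>
  have coeff_P: "coeff (char_poly P) i =
      Polynomial.smult (coeff (char_poly Z) i) (([:0, 1:] - monom 1 p) ^ (N - i))"
    and coeff_eq: "coeff (char_poly (frobenius_twist p Binf)) i = coeff (char_poly Z) i"
    if i: "i \<le> N" for i
  proof -
    obtain c where c: "coeff (char_poly P) i = Polynomial.smult c (([:0, 1:] - monom 1 p) ^ (N - i))"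
      using shift_invariant_poly_eq[OF p pK inv coeff_inf(1)[OF i] coeff_0(1)[OF i]] by blast
    have "c = coeff (char_poly Z) i"
      using coeff_0(2)[OF i] coeff_artin_schreier_power(1)[OF p1, where ?'a = 'K] by (simp add: c)
    with c show "coeff (char_poly P) i =
      Polynomial.smult (coeff (char_poly Z) i) (([:0, 1:] - monom 1 p) ^ (N - i))" by simp
    show "coeff (char_poly (frobenius_twist p Binf)) i = coeff (char_poly Z) i"
      using coeff_inf(2)[OF i] coeff_artin_schreier_power(2)[OF p1, where ?'a = 'K]
        \<open>c = coeff (char_poly Z) i\<close> by (simp add: c)
  qed
  have carr: "frobenius_twist p Binf \<in> carrier_mat N N" "Z \<in> carrier_mat N N"
    using Binf(1) Bzero(1) assms(9,11) by (auto simp: frobenius_twist_def Z_def)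
  have "char_poly (frobenius_twist p Binf) = char_poly Z"
    using char_poly_eqI[OF carr coeff_eq] .
  moreover have "char_poly (p_curvature D p N B) = char_poly ((s_var - s_var ^ p) \<cdot>\<^sub>m map_mat const_rf Z)"
    using char_poly_smult_const_rf[OF p1 CN carr(2)] coeff_P chC by simp
  moreover have "char_poly (p_curvature D p N B) =
      char_poly ((s_var - s_var ^ p) \<cdot>\<^sub>m map_mat const_rf (frobenius_twist p Binf))"
    using char_poly_smult_const_rf[OF p1 CN carr(1)] coeff_P coeff_eq chC by simp
  moreover have "(s_var - s_var ^ p) \<cdot>\<^sub>m map_mat const_rf Z =
      - ((s_var - s_var ^ p) \<cdot>\<^sub>m map_mat const_rf (map_mat (D ^^ (p - 1)) Bzero))"
  proof -
    have "const_rf (- c) = - const_rf c" for c :: 'K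
      by (simp add: const_rf_def flip: of_poly.hom_uminus)
    then show ?thesis unfolding Z_def by (intro eq_matI) auto
  qed
  ultimately show ?thesis by (simp add: isospectral_def Z_def)
qed

end
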